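(* Let $w\in A_\infty^+(\mathbb{R}_-)$, and let $f\ge0$ be locally integrable on $\mathbb{R}_-$ such that $M^+_-f\in L^{p_0}_w(\mathbb{R}_-)$ for some $p_0\in(0,\infty)$. Then, for every $p\ge p_0$, there exists a constant $C=C(p,w)$ (depending only on $p$ and $w$) such that $$\int_{\mathbb{R}_-}(M^+_-f)^p\,w\,dt\le C\int_{\mathbb{R}_-}(M^{+,\sharp}_-f)^p\,w\,dt.$$ Furthermore, if $1<p<\infty$ and $\mathcal{F}\subseteq A_p^+(\mathbb{R}_-)$ satisfies $\sup_{w\in\mathcal{F}}[w]_{A_p^+(\mathbb{R}_-)}<\infty$, then the constants $C(p,w)$ can be chosen in such a way that $\sup_{w\in\mathcal{F}}C(p,w)<\infty$.
   Context: $\mathbb{R}_-=(-\infty,0]$. Functions on $\mathbb{R}_-$ are extended by $0$ to $\mathbb{R}$. For $f\in L^1_{loc}(\mathbb{R}_-)$ and $t\in\mathbb{R}_-$, $$M^+_-f(t)=\sup_{h>0}\frac1h\int_t^{t+h}|f|\,ds,\qquad M^{+,\sharp}_-f(t)=\sup_{h>0}\frac1h\int_t^{t+h}\Big(f(s)-\frac1h\int_{t+h}^{t+2h}f\,d\tau\Big)^+ds,$$ where $x^+=\max(x,0)$. A weight on $\mathbb{R}_-$ is a measurable $w:\mathbb{R}_-\to[0,\infty)$ with $w>0$ a.e.; $w(A)=\int_Aw\,dt$; $L^p_w(\mathbb{R}_-)$ is the $L^p$-space for the measure $w\,dt$. A weight $w$ is in $A_\infty^+(\mathbb{R}_-)$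 if there are $C,\delta>0$ such that $\frac{|S|}{c-a}\le C\big(\frac{w(S)}{w(a,b)}\big)^\delta$ for every $a<b<c\le0$ and every measurable $S\subseteq[b,c]$. For $p\in(1,\infty)$, $w\in A_p^+(\mathbb{R}_-)$ if $[w]_{A_p^+(\mathbb{R}_-)}:=\sup_{a<b<c\le0}\frac1{(c-a)^p}\int_a^bw\,dt\big(\int_b^cw^{1-p'}dt\big)^{p-1}<\infty$, $p'=p/(p-1)$. *)

theory Defs
  imports "HOL-Analysis.Analysis"
begin

text \<open>Functions and weights on the half-line $(-\infty,0]$ are represented by functions on
  \<^typ>\<open>real\<close>; only their values on \<^term>\<open>{..0::real}\<close> matter.\<close>

text \<open>Real powers on $[0,\infty]$, intended for exponents \<open>p > 0\<close> (so that $\infty^p = \infty$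
  and $0^p = 0$).\<close>

definition epowr :: "ennreal \<Rightarrow> real \<Rightarrow> ennreal" where
  "epowr x p = (if x = top then top else ennreal (enn2real x powr p))"

definition ext0 :: "(real \<Rightarrow> real) \<Rightarrow> real \<Rightarrow> real" where
  "ext0 f t = (if t \<le> 0 then f t else 0)"

text \<open>The half-line contains its endpoint \<open>0\<close>, so local integrability includes integrability
  up to \<open>0\<close>.\<close>

definition locally_integrable_neg :: "(real \<Rightarrow> real) \<Rightarrow> bool" where
  "locally_integrable_neg f \<longleftrightarrow> (\<forall>a\<le>0. set_integrable lebesgue {a..0} f)"

definition max_fun :: "(real \<Rightarrow> real) \<Rightarrow> real \<Rightarrow> ennreal" where
  "max_fun f t =
     (SUP h\<in>{0<..}. (\<integral>\<^sup>+s\<in>{t..t+h}. ennreal \<bar>ext0 f s\<bar> \<partial>lebesgue) / ennreal h)"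

definition sharp_max_fun :: "(real \<Rightarrow> real) \<Rightarrow> real \<Rightarrow> ennreal" where
  "sharp_max_fun f t =
     (SUP h\<in>{0<..}.
        (\<integral>\<^sup>+s\<in>{t..t+h}. ennreal (max (ext0 f s - (1 / h) * (LINT \<tau>:{t+h..t+2*h}|lebesgue. ext0 f \<tau>)) 0)
           \<partial>lebesgue) / ennreal h)"

definition weight :: "(real \<Rightarrow> real) \<Rightarrow> bool" where
  "weight w \<longleftrightarrow> w \<in> borel_measurable (lebesgue_on {..0}) \<and> (\<forall>t\<le>0. 0 \<le> w t) \<and>
     (AE t in lebesgue_on {..0}. 0 < w t)"

definition weight_measure :: "(real \<Rightarrow> real) \<Rightarrow> real measure" where
  "weight_measure w = density (lebesgue_on {..0}) (\<lambda>t. ennreal (w t))"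

definition Lp_weighted :: "real \<Rightarrow> (real \<Rightarrow> real) \<Rightarrow> (real \<Rightarrow> ennreal) set" where
  "Lp_weighted p w = {g. g \<in> borel_measurable (weight_measure w) \<and>
     (\<integral>\<^sup>+t. epowr (g t) p \<partial>weight_measure w) < top}"

text \<open>Local integrability of \<open>w\<close> is not part of the definition of a weight, so \<open>w(a,b)\<close> might a
  priori be infinite. As \<open>x / \<infinity> = 0\<close> for finite \<open>x\<close>, the condition below rules this out: test it with
  a set $S = [b,c] \cap \{w \le n\}$ of positive Lebesgue measure. The value of \<open>\<infinity> / \<infinity>\<close> is
  therefore irrelevant, and \<open>w(a,b) > 0\<close> holds for every weight.\<close>

definition A_inf_plus :: "(real \<Rightarrow> real) set" where
  "A_inf_plus = {w. weight w \<and> (\<exists>C>0. \<exists>\<delta>>0. \<forall>a b c S.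
     a < b \<longrightarrow> b < c \<longrightarrow> c \<le> 0 \<longrightarrow> S \<in> sets lebesgue \<longrightarrow> S \<subseteq> {b..c} \<longrightarrow>
       emeasure lebesgue S / ennreal (c - a) \<le>
         ennreal C * epowr (emeasure (weight_measure w) S / emeasure (weight_measure w) {a<..<b}) \<delta>)}"

text \<open>The exponent of \<open>w\<close> is $1 - p'$ with $p' = p/(p-1)$. The null set \<open>{w = 0}\<close>, where the negative
  power is \<open>0\<close> by convention, is irrelevant. Both integrals are positive for every weight, so no
  product \<open>0 \<cdot> \<infinity>\<close> occurs.\<close>

definition Ap_plus_const :: "real \<Rightarrow> (real \<Rightarrow> real) \<Rightarrow> ennreal" where
  "Ap_plus_const p w =
     (SUP (a, b, c)\<in>{(a, b, c). a < b \<and> b < c \<and> c \<le> 0}.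
        (\<integral>\<^sup>+t\<in>{a..b}. ennreal (w t) \<partial>lebesgue) *
        epowr (\<integral>\<^sup>+t\<in>{b..c}. ennreal (w t powr (1 - p / (p - 1))) \<partial>lebesgue) (p - 1)
        / ennreal ((c - a) powr p))"

definition Ap_plus :: "real \<Rightarrow> (real \<Rightarrow> real) set" where
  "Ap_plus p = {w. weight w \<and> Ap_plus_const p w < top}"

end

theory Submission
  imports Defs
begin

text \<open>
  The proof is a good-\<open>\<lambda>\<close> argument in which the two levels \<open>\<alpha>\<close> and \<open>\<rho> * \<alpha>\<close> of the maximal function are
  close to each other, instead of the levels being fixed and the proportion small. Extend \<open>f\<close> by zero to
  a function \<open>g\<close> on the line, let \<open>U\<close> be the open set where the maximal function exceeds \<open>\<alpha>\<close>, and let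
  \<open>E \<subseteq> U\<close> be the set where it exceeds \<open>\<rho> * \<alpha>\<close> while the sharp function is at most \<open>\<gamma> * \<alpha>\<close>.

  Let \<open>b \<notin> U\<close> be the right end point of a component of \<open>U\<close> and \<open>t \<in> E\<close> a point of that component. The
  means of \<open>g\<close> over intervals starting at \<open>b\<close> are at most \<open>\<alpha>\<close>. Hence the sharp function at \<open>t\<close>, tested with
  \<open>h = b - t\<close>, bounds the integral of \<open>(g - \<alpha>)\<^sup>+\<close> over \<open>[t,b]\<close> by \<open>\<gamma> * \<alpha> * (b - t)\<close>, and the rising sun
  lemma turns this into a bound for the Lebesgue measure of \<open>E \<inter> [t,b)\<close>. So \<open>E\<close> fills only a
  small fraction of every interval \<open>[y,b)\<close>, at all scales (\<open>emeasure_exceptional_le\<close>).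

  Of the weight only one quantitative consequence of the Muckenhoupt conditions is used: the mass of an
  interval is at most \<open>K\<close> times the mass of any substantial part of the adjacent interval to its right
  (\<open>forward_comparable\<close>, obtained in \<open>A_inf_plus_forward_comparable\<close> and
  \<open>Ap_plus_forward_comparable\<close>). Along a dyadic decomposition towards \<open>b\<close> it gives that \<open>U\<close> has at most
  \<open>K\<close> times the mass of \<open>U - E\<close>, that is, \<open>E\<close> carries at most the fraction \<open>1 - 1/K\<close> of the mass of
  \<open>U\<close> (\<open>good_lambda\<close>). This fraction need not be small, because it does not depend on \<open>\<rho>\<close>: for
  \<open>\<rho>\<close> close to \<open>1\<close> it is below \<open>\<rho> powr - p\<close>, and integration over all levels absorbs the term with the
  maximal function (\<open>nn_integral_epowr_le_of_good_lambda\<close>). The integrability of the maximal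
  function to the power \<open>p0\<close> makes the absorbed quantities finite.
\<close>

section \<open>Comparing two measures on an open set\<close>

lemma component_half_open_interval:
  fixes U :: "real set"
  assumes U: "open U" "bdd_above U" and C: "C \<in> components U" and x: "x \<in> C"
  shows "{x..<Sup C} \<subseteq> C" "Sup C \<notin> U" "C \<subseteq> {..<Sup C}"
proof -
  have ne: "C \<noteq> {}" and sub: "C \<subseteq> U" and opn: "open C" and conn: "connected C"
    using C U in_components_nonempty in_components_subset open_components in_components_connected
    by blast+
  have bdd: "bdd_above C" using U(2) sub by (rule bdd_above_mono)
  show "{x..<Sup C} \<subseteq> C"
  proof
    fix y assume y: "y \<in> {x..<Sup C}"
    then obtain z where "z \<in> C" "y < z" using less_cSup_iff[OF ne bdd] by auto
    then show "y \<in> C" using connectedD_interval[OF conn x, of z y] y by auto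
  qed
  show "Sup C \<notin> U"
  proof
    assume S: "Sup C \<in> U"
    then obtain e where e: "e > 0" "ball (Sup C) e \<subseteq> U" using U(1) open_contains_ball by blast
    obtain z where z: "z \<in> C" "Sup C - e < z" using less_cSup_iff[OF ne bdd, of "Sup C - e"] e by auto
    have "z \<le> Sup C" by (simp add: bdd cSup_upper z(1))
    then have "z \<in> ball (Sup C) e" using z by (auto simp: dist_real_def)
    then have "ball (Sup C) e \<subseteq> C"
      using components_maximal[OF C convex_connected[OF convex_ball] e(2)] z by blast
    moreover have "Sup C + e/2 \<in> ball (Sup C) e" using e by (auto simp: dist_real_def)
    ultimately have "Sup C + e/2 \<le> Sup C" by (intro cSup_upper bdd) auto
    then show False using e by auto
  qed
  then show "C \<subseteq> {..<Sup C}"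
    using sub cSup_upper[OF _ bdd] by (force simp: order.strict_iff_order)
qed

text \<open>An inequality between two measures of an open set needs checking only on the half-open intervals
  that are contained in the set and whose right end point is not. Both the weak-type estimate and the weighted comparison
  below use it; in each case a rising sun or dyadic argument provides the inequality on such an
  interval.\<close>

lemma emeasure_le_by_half_open_intervals:
  fixes U :: "real set"
  assumes U: "open U" "bdd_above U"
    and M: "sets borel \<subseteq> sets M" and N: "sets borel \<subseteq> sets N"
    and le: "\<And>x b. x < b \<Longrightarrow> {x..<b} \<subseteq> U \<Longrightarrow> b \<notin> U \<Longrightarrow> emeasure M {x..<b} \<le> emeasure N {x..<b}"
  shows "emeasure M U \<le> emeasure N U"
proof -
  have comp: "emeasure M C \<le> emeasure N C" if C: "C \<in> components U" for C
  proof -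
    define b where "b = Sup C"
    have opn: "open C" and sub: "C \<subseteq> U"
      using C U in_components_subset open_components by blast+
    note half = component_half_open_interval[OF U C, folded b_def]
    obtain q :: "nat \<Rightarrow> real" where q: "range q = \<rat>"
      by (metis countable_rat from_nat_into Rats_0 empty_iff range_from_nat_into)
    define A where "A n = (\<Union>i\<in>{i. i < n \<and> q i \<in> C}. {q i..<b})" for n :: nat
    \<comment> \<open>A finite union of intervals with common right end point is one of them.\<close>
    have A_cases: "A n = {} \<or> (\<exists>x\<in>C. A n = {x..<b})" for n
    proof (induction n)
      case (Suc n)
      show ?case
      proof (cases "q n \<in> C")
        case True
        then have "{i. i < Suc n \<and> q i \<in> C} = insert n {i. i < n \<and> q i \<in> C}"
          by (auto simp: less_Suc_eq)
        then have A': "A (Suc n) = {q n..<b} \<union> A n" by (simp add: A_def)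
        from Suc show ?thesis
        proof
          assume "\<exists>x\<in>C. A n = {x..<b}"
          then obtain x where x: "x \<in> C" "A n = {x..<b}" by blast
          have "A (Suc n) = {min x (q n)..<b}" unfolding A' x by auto
          moreover have "min x (q n) \<in> C" using x True by (simp add: min_def)
          ultimately show ?thesis by blast
        qed (use True A' in auto)
      next
        case False
        then have "{i. i < Suc n \<and> q i \<in> C} = {i. i < n \<and> q i \<in> C}"
          by (auto simp: less_Suc_eq)
        with Suc show ?thesis by (simp add: A_def)
      qed
    qed (simp add: A_def)
    have A_borel: "A n \<in> sets borel" for n by (simp add: A_def)
    have A_Un: "(\<Union>n. A n) = C"
    proof
      show "(\<Union>n. A n) \<subseteq> C" using half by (auto simp: A_def)
      show "C \<subseteq> (\<Union>n. A n)"
      proof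
        fix x assume x: "x \<in> C"
        then obtain e where e: "e > 0" "ball x e \<subseteq> C" using opn open_contains_ball by blast
        obtain r where r: "r \<in> \<rat>" "x - e < r" "r < x" using Rats_dense_in_real[of "x-e" x] e by auto
        then obtain i where i: "r = q i" using q by blast
        have "r \<in> ball x e" using r by (auto simp: dist_real_def)
        then have "q i \<in> C" using e i by auto
        then have "x \<in> A (Suc i)" using r i half(3)[OF x] x by (force simp: A_def)
        then show "x \<in> (\<Union>n. A n)" by blast
      qed
    qed
    have A_sets: "range A \<subseteq> sets M" using A_borel M by auto
    have inc: "incseq A" unfolding A_def by (intro monoI UN_mono) auto
    have "emeasure M (A n) \<le> emeasure N C" for n
      using A_cases[of n]
    proof
      assume "\<exists>x\<in>C. A n = {x..<b}"
      then obtain x where x: "x \<in> C" "A n = {x..<b}" by blast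
      have "x < b" using half(3)[OF x(1)] x by auto
      then have "emeasure M {x..<b} \<le> emeasure N {x..<b}"
        using half[OF x(1)] sub by (intro le) auto
      also have "\<dots> \<le> emeasure N C"
        using half[OF x(1)] opn N by (intro emeasure_mono) auto
      finally show ?thesis by (simp add: x)
    qed auto
    moreover have "emeasure M C = (SUP n. emeasure M (A n))"
      using SUP_emeasure_incseq[OF A_sets inc] A_Un by simp
    ultimately show ?thesis by (simp add: SUP_le_iff)
  qed
  have disj: "disjoint (components U)"
    using pairwise_disjoint_components[of U] by (simp add: pairwise_def disjnt_def)
  have cnt: "countable (components U)"
    using open_components[OF U(1)] disj by (rule countable_disjoint_open_subsets)
  have opn: "C \<in> sets borel" if "C \<in> components U" for C
    using open_components[OF U(1) that] by (rule borel_open)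
  have sum: "emeasure L U = (\<integral>\<^sup>+C. emeasure L C \<partial>count_space (components U))"
    if L: "sets borel \<subseteq> sets L" for L
    using emeasure_UN_countable[of "components U" "\<lambda>C. C" L] disj cnt opn L
    by (simp add: disjoint_family_on_def disjoint_def subset_iff)
  show ?thesis unfolding sum[OF M] sum[OF N]
    using comp by (intro nn_integral_mono) simp
qed

section \<open>Level sets of the forward maximal and sharp maximal functions\<close>

text \<open>For \<open>g \<ge> 0\<close> and \<open>\<kappa> \<ge> 0\<close> this is the set where the forward maximal function of \<open>g\<close>
  exceeds \<open>\<kappa>\<close>, written with real-valued integrals and without division.\<close>

definition max_level :: "(real \<Rightarrow> real) \<Rightarrow> real \<Rightarrow> real set" where
  "max_level g \<kappa> = {t. \<exists>h>0. \<kappa> * h < integral {t..t+h} g}"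

text \<open>\<open>h\<close> times the quotient of which the sharp maximal function is the supremum over \<open>h\<close>.\<close>

definition upper_osc :: "(real \<Rightarrow> real) \<Rightarrow> real \<Rightarrow> real \<Rightarrow> real" where
  "upper_osc g h t = integral {t..t+h} (\<lambda>s. max (g s - integral {t+h..t+2*h} g / h) 0)"

text \<open>The superlevel sets of the sharp maximal function.\<close>

definition sharp_level :: "(real \<Rightarrow> real) \<Rightarrow> real \<Rightarrow> real set" where
  "sharp_level g \<mu> = {t. \<exists>h>0. \<mu> * h < upper_osc g h t}"

lemma not_in_max_levelD: "t \<notin> max_level g \<kappa> \<Longrightarrow> 0 < h \<Longrightarrow> integral {t..t+h} g \<le> \<kappa> * h"
  unfolding max_level_def mem_Collect_eq by (meson not_less)

lemma max_level_mono: "\<kappa> \<le> \<kappa>' \<Longrightarrow> max_level g \<kappa>' \<subseteq> max_level g \<kappa>"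
  unfolding max_level_def by (blast intro: le_less_trans[OF mult_right_mono] less_imp_le)

text \<open>The functions of this locale live on the whole line; the extension by \<open>0\<close> of a nonnegative locally
  integrable function on the closed half-line is one of them.\<close>

locale nonneg_loc_integrable =
  fixes g :: "real \<Rightarrow> real"
  assumes nonneg: "\<And>x. 0 \<le> g x" and loc_int: "\<And>a b. set_integrable lebesgue {a..b} g"
begin

lemma hk_integrable: "g integrable_on {a..b}"
  using loc_int set_lebesgue_integral_eq_integral by blast

lemma set_integrable_excess: "set_integrable lebesgue {a..b} (\<lambda>s. max (g s - c) 0)"
proof -
  have "set_integrable lebesgue {a..b} (\<lambda>s. g s - c)"
    by (intro set_integral_diff loc_int absolutely_integrable_on_const) auto
  then show ?thesis by (intro absolutely_integrable_max_1) auto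
qed

lemma hk_integrable_excess: "(\<lambda>s. max (g s - c) 0) integrable_on {a..b}"
  using set_integrable_excess set_lebesgue_integral_eq_integral by blast

lemma continuous_moving_integral:
  fixes f :: "real \<Rightarrow> real"
  assumes f: "\<And>a b. f integrable_on {a..b}" and hk: "h \<le> k"
  shows "continuous_on UNIV (\<lambda>t. integral {t+h..t+k} f)"
proof -
  have "isCont (\<lambda>t. integral {t+h..t+k} f) t0" for t0
  proof -
    define A where "A = t0 + h - 1"
    define B where "B = t0 + k + 1"
    have c: "continuous_on {A..B} (\<lambda>x. integral {A..x} f)"
      by (intro indefinite_integral_continuous_1 f)
    have eq: "integral {t+h..t+k} f = integral {A..t+k} f - integral {A..t+h} f"
      if "t \<in> {t0-1<..<t0+1}" for t
      using Henstock_Kurzweil_Integration.integral_combine[of A "t+h" "t+k" f] f hk that by (simp add: A_def)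
    have "continuous_on {t0-1<..<t0+1} (\<lambda>t. integral {A..t+k} f - integral {A..t+h} f)"
      using hk by (intro continuous_intros continuous_on_compose2[OF c]) (auto simp: A_def B_def)
    then have "continuous_on {t0-1<..<t0+1} (\<lambda>t. integral {t+h..t+k} f)"
      by (rule continuous_on_eq) (use eq in auto)
    then show ?thesis by (simp add: continuous_on_eq_continuous_at)
  qed
  then show ?thesis by (simp add: continuous_at_imp_continuous_on)
qed

lemma open_max_level: "open (max_level g \<kappa>)"
proof -
  have "max_level g \<kappa> = (\<Union>h\<in>{0<..}. {t. \<kappa> * h < integral {t+0..t+h} g})"
    by (auto simp: max_level_def)
  also have "open \<dots>"
    by (intro open_UN ballI open_Collect_less continuous_moving_integral hk_integrable
        continuous_on_const) auto
  finally show ?thesis .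
qed

lemma integral_excess_antimono:
  assumes "c \<le> c'"
  shows "integral {a..b} (\<lambda>s. max (g s - c') 0) \<le> integral {a..b} (\<lambda>s. max (g s - c) 0)"
  using assms by (intro integral_le hk_integrable_excess) auto

text \<open>The mean subtracted in \<^const>\<open>upper_osc\<close> depends on \<open>t\<close>. The proof replaces it by arbitrary larger
  constants \<open>c\<close>, so that only integrals of fixed functions over moving intervals have to be continuous
  in \<open>t\<close>.\<close>

lemma open_sharp_level: "open (sharp_level g \<mu>)"
proof -
  have "sharp_level g \<mu> = (\<Union>h\<in>{0<..}. \<Union>c. {t. integral {t+h..t+2*h} g < c * h} \<inter>
      {t. \<mu> * h < integral {t+0..t+h} (\<lambda>s. max (g s - c) 0)})" (is "_ = ?R")
  proof
    show "?R \<subseteq> sharp_level g \<mu>"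
    proof
      fix t assume "t \<in> ?R"
      then obtain h c where h: "h > 0" "integral {t+h..t+2*h} g < c * h"
        "\<mu> * h < integral {t..t+h} (\<lambda>s. max (g s - c) 0)" by auto
      have "integral {t+h..t+2*h} g / h \<le> c" using h by (simp add: field_simps)
      then have "\<mu> * h < upper_osc g h t"
        unfolding upper_osc_def using integral_excess_antimono h(3) by (meson less_le_trans)
      then show "t \<in> sharp_level g \<mu>" using h by (auto simp: sharp_level_def)
    qed
    show "sharp_level g \<mu> \<subseteq> ?R"
    proof
      fix t assume "t \<in> sharp_level g \<mu>"
      then obtain h where h: "h > 0" "\<mu> * h < upper_osc g h t" by (auto simp: sharp_level_def)
      define A where "A = integral {t+h..t+2*h} g / h"
      \<comment> \<open>Raising the constant by \<open>c - A\<close> costs half of the excess of the oscillation over \<open>\<mu> * h\<close>.\<close>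
      define c where "c = A + (upper_osc g h t - \<mu> * h) / (2*h)"
      have "c > A" using h by (simp add: c_def)
      then have c1: "integral {t+h..t+2*h} g < c * h" using h by (simp add: A_def field_simps)
      have "upper_osc g h t \<le> integral {t..t+h} (\<lambda>s. max (g s - c) 0 + (c - A))"
        unfolding upper_osc_def A_def[symmetric] using \<open>c > A\<close>
        by (intro integral_le hk_integrable_excess integrable_add) auto
      also have "\<dots> = integral {t..t+h} (\<lambda>s. max (g s - c) 0) + (c - A) * h"
        using h by (subst Henstock_Kurzweil_Integration.integral_add) (auto intro: hk_integrable_excess)
      also have "(c - A) * h = (upper_osc g h t - \<mu> * h) / 2" using h by (simp add: c_def)
      finally have "\<mu> * h < integral {t..t+h} (\<lambda>s. max (g s - c) 0)" using h by argo
      then show "t \<in> ?R" using h c1 by auto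
    qed
  qed
  also have "open \<dots>"
    by (intro open_UN ballI open_Int open_Collect_less continuous_moving_integral hk_integrable
        hk_integrable_excess continuous_on_const) auto
  finally show ?thesis .
qed

text \<open>The rising sun lemma. The end point \<open>d\<close> lies outside the level set, so an interval that starts left
  of \<open>d\<close>, has a large mean and reaches beyond \<open>d\<close> can be cut off at \<open>d\<close>.\<close>

lemma rising_sun:
  assumes x: "x < d" and sub: "{x..<d} \<subseteq> max_level g \<kappa>" and d: "d \<notin> max_level g \<kappa>"
  shows "\<kappa> * (d - x) \<le> integral {x..d} g"
proof -
  define F where "F y = integral {x..y} g - \<kappa> * (y - x)" for y
  define S where "S = {y \<in> {x..d}. 0 \<le> F y}"
  have "continuous_on {x..d} (\<lambda>y. integral {x..y} g)"
    by (rule indefinite_integral_continuous_1[OF hk_integrable])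
  then have F: "continuous_on {x..d} F" unfolding F_def by (intro continuous_intros) auto
  have "closed S" unfolding S_def
    by (intro continuous_on_closed_Collect_le F) auto
  have "x \<in> S" using x by (simp add: S_def F_def)
  have "bdd_above S" by (auto simp: S_def)
  define y where "y = Sup S"
  have "y \<in> S" unfolding y_def
    using \<open>closed S\<close> \<open>bdd_above S\<close> \<open>x \<in> S\<close> closed_contains_Sup by blast
  show ?thesis
  proof (cases "y = d")
    case True
    then show ?thesis using \<open>y \<in> S\<close> by (simp add: S_def F_def)
  next
    case False
    then have y: "x \<le> y" "y < d" "0 \<le> F y" using \<open>y \<in> S\<close> by (auto simp: S_def)
    then obtain h where h: "h > 0" "\<kappa> * h < integral {y..y+h} g"
      using sub by (auto simp: max_level_def)
    have comb: "integral {x..z} g = integral {x..y} g + integral {y..z} g" if "y \<le> z" for z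
      using Henstock_Kurzweil_Integration.integral_combine[of x y z g] y that hk_integrable by simp
    show ?thesis
    proof (cases "y + h \<le> d")
      case True
      have "y + h \<in> S" using True y h comb[of "y+h"] by (auto simp: S_def F_def algebra_simps)
      then have "y + h \<le> y" unfolding y_def using \<open>bdd_above S\<close> by (rule cSup_upper)
      then show ?thesis using h by simp
    next
      case False
      have "integral {d..y+h} g \<le> \<kappa> * (y+h-d)"
        using not_in_max_levelD[OF d, of "y+h-d"] False by simp
      moreover have "integral {y..y+h} g = integral {y..d} g + integral {d..y+h} g"
        using Henstock_Kurzweil_Integration.integral_combine[of y d "y+h" g] y False hk_integrable by simp
      ultimately have "\<kappa> * (d - y) \<le> integral {y..d} g" using h by (simp add: algebra_simps)
      then show ?thesis using y comb[of d] by (simp add: F_def algebra_simps)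
    qed
  qed
qed

text \<open>The only place where the sharp function enters. Its quotient is used with the length \<open>h = b - t\<close>:
  then the subtracted mean is taken over an interval starting at \<open>b\<close> and is at most \<open>\<alpha>\<close>.\<close>

lemma integral_excess_le:
  assumes \<alpha>: "b \<notin> max_level g \<alpha>" and t: "t < b" and \<mu>: "t \<notin> sharp_level g \<mu>"
  shows "integral {t..b} (\<lambda>s. max (g s - \<alpha>) 0) \<le> \<mu> * (b - t)"
proof -
  define h where "h = b - t"
  have h: "h > 0" "t + h = b" "t + 2 * h = b + h" using t by (auto simp: h_def)
  have "integral {b..b+h} g \<le> \<alpha> * h" by (rule not_in_max_levelD[OF \<alpha> h(1)])
  then have "integral {t+h..t+2*h} g / h \<le> \<alpha>" unfolding h(2,3) using h(1) by (simp add: field_simps)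
  then have "integral {t..b} (\<lambda>s. max (g s - \<alpha>) 0) \<le> upper_osc g h t"
    unfolding upper_osc_def h(2) by (rule integral_excess_antimono)
  also have "\<dots> \<le> \<mu> * h" using \<mu> h(1) unfolding sharp_level_def mem_Collect_eq by (meson not_less)
  finally show ?thesis by (simp add: h_def)
qed

lemma nn_integral_excess:
  "(\<integral>\<^sup>+s\<in>{a..b}. ennreal (max (g s - c) 0) \<partial>lebesgue)
     = ennreal (integral {a..b} (\<lambda>s. max (g s - c) 0))"
  using nn_integral_has_integral_lebesgue'[OF _ integrable_integral[OF hk_integrable_excess]]
  by (simp add: nn_integral_completion)

text \<open>A weak-type estimate: on each maximal interval where the maximal function exceeds \<open>\<kappa>\<close>, the mean of
  \<open>g - \<alpha>\<close> is at least \<open>\<kappa> - \<alpha>\<close>.\<close>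

lemma emeasure_max_level_Int_le:
  assumes \<alpha>: "b \<notin> max_level g \<alpha>" and t: "t < b" and \<mu>: "t \<notin> sharp_level g \<mu>"
    and s: "\<alpha> < \<kappa>"
  shows "emeasure lebesgue (max_level g \<kappa> \<inter> {t<..<b}) \<le> ennreal (\<mu> / (\<kappa> - \<alpha>) * (b - t))"
proof -
  define V where "V = max_level g \<kappa> \<inter> {t<..<b}"
  define M :: "real measure" where "M = density lebesgue (\<lambda>_. ennreal (\<kappa> - \<alpha>))"
  define N :: "real measure" where "N = density lebesgue (\<lambda>s. ennreal (max (g s - \<alpha>) 0) * indicator {t..b} s)"
  have meas: "(\<lambda>s. ennreal (max (g s - \<alpha>) 0) * indicator {t..b} s) \<in> borel_measurable lebesgue"
  proof -
    have "(\<lambda>s. indicator {t..b} s *\<^sub>R max (g s - \<alpha>) 0) \<in> borel_measurable lebesgue"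
      using set_integrable_excess by (auto simp: set_integrable_def)
    then have "(\<lambda>s. ennreal (indicator {t..b} s *\<^sub>R max (g s - \<alpha>) 0)) \<in> borel_measurable lebesgue"
      by measurable
    then show ?thesis
      by (rule measurable_cong[THEN iffD1, rotated]) (auto simp: indicator_def)
  qed
  have V: "open V" "bdd_above V" unfolding V_def
    by (auto intro: open_Int open_max_level bdd_above_mono[of "{t<..<b}"])
  have "emeasure M V \<le> emeasure N V"
  proof (rule emeasure_le_by_half_open_intervals[OF V])
    show "sets borel \<subseteq> sets M" "sets borel \<subseteq> sets N" by (auto simp: M_def N_def)
    fix x d assume x: "x < d" "{x..<d} \<subseteq> V" "d \<notin> V"
    have tx: "t < x" using x by (auto simp: V_def)
    have db: "d \<le> b"
    proof (rule ccontr)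
      assume "\<not> d \<le> b"
      then have "max x b \<in> {x..<d}" using x by auto
      then have "max x b \<in> V" using x(2) by blast
      then show False by (auto simp: V_def)
    qed
    have "d \<notin> max_level g \<kappa>"
    proof (cases "d = b")
      case True
      then show ?thesis using \<alpha> max_level_mono[of \<alpha> \<kappa> g] s by auto
    next
      case False
      then show ?thesis using x tx db by (auto simp: V_def)
    qed
    then have "\<kappa> * (d - x) \<le> integral {x..d} g"
      using x by (intro rising_sun) (auto simp: V_def)
    also have "\<dots> \<le> integral {x..d} (\<lambda>s. max (g s - \<alpha>) 0 + \<alpha>)"
      by (intro integral_le hk_integrable hk_integrable_excess integrable_add) auto
    also have "\<dots> = integral {x..d} (\<lambda>s. max (g s - \<alpha>) 0) + \<alpha> * (d - x)"
      using x by (subst Henstock_Kurzweil_Integration.integral_add) (auto intro: hk_integrable_excess)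
    finally have le: "(\<kappa> - \<alpha>) * (d - x) \<le> integral {x..d} (\<lambda>s. max (g s - \<alpha>) 0)"
      by (simp add: algebra_simps)
    have "emeasure M {x..<d} = ennreal ((\<kappa> - \<alpha>) * (d - x))"
      using x s by (simp add: M_def emeasure_density nn_integral_cmult_indicator ennreal_mult)
    also have "\<dots> \<le> (\<integral>\<^sup>+s\<in>{x..d}. ennreal (max (g s - \<alpha>) 0) \<partial>lebesgue)"
      unfolding nn_integral_excess using le by (rule ennreal_leI)
    also have "\<dots> = (\<integral>\<^sup>+s\<in>{x..<d}. ennreal (max (g s - \<alpha>) 0) \<partial>lebesgue)"
    proof (rule nn_integral_cong_AE)
      have "AE s in lebesgue. s \<noteq> d" by (intro AE_completion AE_lborel_singleton)
      then show "AE s in lebesgue. ennreal (max (g s - \<alpha>) 0) * indicator {x..d} s =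
          ennreal (max (g s - \<alpha>) 0) * indicator {x..<d} s"
        by eventually_elim (auto simp: indicator_def)
    qed
    also have "\<dots> = emeasure N {x..<d}"
      unfolding N_def using meas tx db
      by (subst emeasure_density) (auto intro!: nn_integral_cong simp: indicator_def)
    finally show "emeasure M {x..<d} \<le> emeasure N {x..<d}" .
  qed
  also have "\<dots> \<le> (\<integral>\<^sup>+s\<in>{t..b}. ennreal (max (g s - \<alpha>) 0) \<partial>lebesgue)"
    unfolding N_def using meas V(1)
    by (subst emeasure_density) (auto intro!: nn_integral_mono simp: indicator_def)
  also have "\<dots> \<le> ennreal (\<mu> * (b - t))"
    unfolding nn_integral_excess using integral_excess_le[OF \<alpha> t \<mu>] by (rule ennreal_leI)
  finally have *: "ennreal (\<kappa> - \<alpha>) * emeasure lebesgue V \<le> ennreal (\<mu> * (b - t))"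
    using V(1) by (simp add: M_def emeasure_density nn_integral_cmult_indicator)
  have "emeasure lebesgue V = ennreal (1 / (\<kappa> - \<alpha>)) * (ennreal (\<kappa> - \<alpha>) * emeasure lebesgue V)"
    using s by (simp add: mult.assoc[symmetric] ennreal_mult[symmetric])
  also have "\<dots> \<le> ennreal (1 / (\<kappa> - \<alpha>)) * ennreal (\<mu> * (b - t))"
    by (rule mult_left_mono[OF *]) auto
  also have "\<dots> = ennreal (\<mu> / (\<kappa> - \<alpha>) * (b - t))"
    using s by (simp add: ennreal_mult'[symmetric])
  finally show ?thesis by (simp add: V_def)
qed

text \<open>The preceding estimate is applied at a point \<open>t\<close> of the exceptional set that nearly attains its
  infimum, so that the part of the set to the left of \<open>t\<close> is short. The factor \<open>2\<close> accounts for that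
  part.\<close>

lemma emeasure_exceptional_le:
  assumes \<alpha>: "b \<notin> max_level g \<alpha>" and x: "x < b" and \<mu>: "0 < \<mu>" and s: "\<alpha> < \<kappa>"
  shows "emeasure lebesgue ((max_level g \<kappa> - sharp_level g \<mu>) \<inter> {x..<b})
    \<le> ennreal (2 * \<mu> / (\<kappa> - \<alpha>) * (b - x))"
proof -
  define E where "E = (max_level g \<kappa> - sharp_level g \<mu>) \<inter> {x..<b}"
  show ?thesis
  proof (cases "E = {}")
    case False
    define \<eta> where "\<eta> = \<mu> / (\<kappa> - \<alpha>) * (b - x)"
    have \<eta>: "\<eta> > 0" using assms by (simp add: \<eta>_def)
    define m where "m = Inf E"
    have bdd: "bdd_below E" by (auto simp: E_def)
    obtain t where t: "t \<in> E" "t < m + \<eta>"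
      using cInf_less_iff[OF False bdd, of "m + \<eta>"] \<eta> by (auto simp: m_def)
    have mt: "m \<le> t" unfolding m_def by (intro cInf_lower t bdd)
    have t': "x \<le> t" "t < b" "t \<notin> sharp_level g \<mu>" using t by (auto simp: E_def)
    have "E \<subseteq> {m..t} \<union> (max_level g \<kappa> \<inter> {t<..<b})"
    proof
      fix y assume y: "y \<in> E"
      then have "m \<le> y" unfolding m_def by (intro cInf_lower bdd)
      then show "y \<in> {m..t} \<union> (max_level g \<kappa> \<inter> {t<..<b})" using y by (auto simp: E_def)
    qed
    then have "emeasure lebesgue E \<le> emeasure lebesgue ({m..t} \<union> (max_level g \<kappa> \<inter> {t<..<b}))"
      using open_max_level by (intro emeasure_mono) auto
    also have "\<dots> \<le> emeasure lebesgue {m..t} + emeasure lebesgue (max_level g \<kappa> \<inter> {t<..<b})"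
      using open_max_level by (intro emeasure_subadditive) auto
    also have "\<dots> \<le> ennreal (t - m) + ennreal (\<mu> / (\<kappa> - \<alpha>) * (b - t))"
      using emeasure_max_level_Int_le[OF \<alpha> t'(2,3) s] mt by (intro add_mono) auto
    also have "\<dots> = ennreal (t - m + \<mu> / (\<kappa> - \<alpha>) * (b - t))"
      using mt t' \<mu> s by (subst ennreal_plus) auto
    also have "\<dots> \<le> ennreal (2 * \<mu> / (\<kappa> - \<alpha>) * (b - x))"
    proof (rule ennreal_leI)
      have "\<mu> / (\<kappa> - \<alpha>) * (b - t) \<le> \<eta>"
        unfolding \<eta>_def using t' \<mu> s by (intro mult_left_mono) auto
      then show "t - m + \<mu> / (\<kappa> - \<alpha>) * (b - t) \<le> 2 * \<mu> / (\<kappa> - \<alpha>) * (b - x)"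
        using t(2) by (simp add: \<eta>_def)
    qed
    finally show ?thesis by (simp add: E_def)
  qed (simp add: E_def)
qed

end

section \<open>The measure of a weight\<close>

lemma interval_in_sets_lebesgue [simp, measurable]:
  fixes a b :: real
  shows "{a..b} \<in> sets lebesgue" "{a..<b} \<in> sets lebesgue" "{..b} \<in> sets lebesgue"
  by (auto intro: sets_completionI_sets)

lemma borel_measurable_extend_weight:
  assumes "weight w"
  shows "(\<lambda>t. ennreal (w t) * indicator {..0} t) \<in> borel_measurable lebesgue"
proof -
  have "(\<lambda>t. ennreal (w t)) \<in> borel_measurable (lebesgue_on {..0})"
    using assms by (auto simp: weight_def)
  then show ?thesis by (subst (asm) borel_measurable_restrict_space_iff_ennreal) auto
qed

lemma emeasure_weight_measure:
  assumes w: "weight w" and S: "S \<in> sets lebesgue" "S \<subseteq> {..0}"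
  shows "emeasure (weight_measure w) S = (\<integral>\<^sup>+t\<in>S. ennreal (w t) \<partial>lebesgue)"
proof -
  have [measurable]: "(\<lambda>t. ennreal (w t)) \<in> borel_measurable (lebesgue_on {..0})"
    using w by (auto simp: weight_def)
  have S': "S \<in> sets (lebesgue_on {..0})" using S by (simp add: sets_restrict_space_iff)
  have "emeasure (weight_measure w) S = (\<integral>\<^sup>+t\<in>S. ennreal (w t) \<partial>lebesgue_on {..0})"
    unfolding weight_measure_def using S' by (subst emeasure_density) auto
  also have "\<dots> = (\<integral>\<^sup>+t\<in>S. ennreal (w t) \<partial>lebesgue)"
    using S(2) by (subst nn_integral_restrict_space) (auto intro!: nn_integral_cong simp: indicator_def)
  finally show ?thesis .
qed

lemma sets_weight_measure: "sets (weight_measure w) = sets (lebesgue_on {..0})"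
  by (simp add: weight_measure_def)

lemma in_sets_weight_measure:
  "S \<in> sets (weight_measure w) \<longleftrightarrow> S \<in> sets lebesgue \<and> S \<subseteq> {..0}"
  by (auto simp: sets_weight_measure sets_restrict_space_iff)

lemma emeasure_weight_measure_null:
  assumes w: "weight w" and S: "S \<in> sets lebesgue" "S \<subseteq> {..0}" "emeasure lebesgue S = 0"
  shows "emeasure (weight_measure w) S = 0"
proof -
  have "AE t in lebesgue. t \<notin> S" using S by (intro AE_not_in) auto
  then have "AE t in lebesgue. ennreal (w t) * indicator S t = 0"
    by eventually_elim simp
  from nn_integral_cong_AE[OF this] show ?thesis by (simp add: emeasure_weight_measure[OF w S(1,2)])
qed

lemma emeasure_weight_measure_half_open:
  assumes w: "weight w" and x: "x < y" "y \<le> 0"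
  shows "emeasure (weight_measure w) {x..<y} = emeasure (weight_measure w) {x<..<y}"
proof -
  have eq: "{x..<y} = insert x {x<..<y}" using x by auto
  have "emeasure (weight_measure w) {x} = 0"
    using w x by (intro emeasure_weight_measure_null) auto
  then show ?thesis unfolding eq using x
    by (subst emeasure_insert) (auto simp: in_sets_weight_measure)
qed

lemma sigma_finite_lebesgue: "sigma_finite_measure (lebesgue :: real measure)"
proof
  obtain A :: "real set set" where A: "countable A" "A \<subseteq> sets lborel" "\<Union>A = space lborel"
      "\<forall>a\<in>A. emeasure lborel a \<noteq> \<infinity>"
    using lborel.sigma_finite_countable by blast
  moreover have "A \<subseteq> sets lebesgue" using A(2) by (auto intro: sets_completionI_sets)
  moreover have "\<forall>a\<in>A. emeasure lebesgue a \<noteq> \<infinity>" using A by auto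
  ultimately show "\<exists>A. countable A \<and> A \<subseteq> sets (lebesgue :: real measure) \<and>
      \<Union>A = space lebesgue \<and> (\<forall>a\<in>A. emeasure lebesgue a \<noteq> \<infinity>)"
    by (intro exI[of _ A]) simp
qed

lemma sigma_finite_weight_measure:
  assumes w: "weight w"
  shows "sigma_finite_measure (weight_measure w)"
proof -
  have "(\<lambda>t. ennreal (w t)) \<in> borel_measurable (lebesgue_on {..0})"
    using w by (auto simp: weight_def)
  then show ?thesis
    unfolding weight_measure_def
    by (subst sigma_finite_measure.sigma_finite_iff_density_finite) (auto intro: sigma_finite_measure_restrict_space sigma_finite_lebesgue)
qed

section \<open>Comparison of adjacent intervals\<close>

text \<open>The only quantitative property of the weight that the argument needs: the mass of an interval \<open>(a,b)\<close> is at most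
  \<open>K\<close> times the mass of each subset of the adjacent interval \<open>[b,c]\<close> that has at least one sixth of the
  length \<open>c - a\<close>. The fraction \<open>1/6\<close> is the one that a dyadic decomposition towards an end point
  produces.\<close>

definition forward_comparable :: "real \<Rightarrow> (real \<Rightarrow> real) \<Rightarrow> bool" where
  "forward_comparable K w \<longleftrightarrow> (\<forall>a b c S. a < b \<longrightarrow> b < c \<longrightarrow> c \<le> 0 \<longrightarrow> S \<in> sets lebesgue \<longrightarrow>
     S \<subseteq> {b..c} \<longrightarrow> ennreal ((c - a) / 6) \<le> emeasure lebesgue S \<longrightarrow>
     emeasure (weight_measure w) {a<..<b} \<le> ennreal K * emeasure (weight_measure w) S)"

lemma forward_comparableD:
  "\<lbrakk>forward_comparable K w; a < b; b < c; c \<le> 0; S \<in> sets lebesgue; S \<subseteq> {b..c};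
     ennreal ((c - a) / 6) \<le> emeasure lebesgue S\<rbrakk> \<Longrightarrow>
     emeasure (weight_measure w) {a<..<b} \<le> ennreal K * emeasure (weight_measure w) S"
  by (simp add: forward_comparable_def)

lemma forward_comparable_mono:
  assumes "forward_comparable K w" "K \<le> K'"
  shows "forward_comparable K' w"
  using assms unfolding forward_comparable_def
  by (meson ennreal_leI mult_right_mono order_trans zero_le)

lemma A_inf_plus_forward_comparable:
  assumes "w \<in> A_inf_plus"
  shows "weight w" "\<exists>K. forward_comparable K w"
proof -
  show "weight w" using assms by (simp add: A_inf_plus_def)
  let ?W = "emeasure (weight_measure w)"
  from assms obtain C \<delta> where C: "C > 0" "\<delta> > 0" and A: "\<And>a b c S. a < b \<Longrightarrow> b < c \<Longrightarrow> c \<le> 0 \<Longrightarrow>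
      S \<in> sets lebesgue \<Longrightarrow> S \<subseteq> {b..c} \<Longrightarrow>
       emeasure lebesgue S / ennreal (c - a) \<le> ennreal C * epowr (?W S / ?W {a<..<b}) \<delta>"
    unfolding A_inf_plus_def by blast
  define K where "K = (6 * C) powr (1 / \<delta>)"
  have K: "K > 0" using C by (simp add: K_def)
  have "forward_comparable K w"
    unfolding forward_comparable_def
  proof (intro allI impI)
    fix a b c :: real and S
    assume *: "a < b" "b < c" "c \<le> 0" "S \<in> sets lebesgue" "S \<subseteq> {b..c}"
      "ennreal ((c - a) / 6) \<le> emeasure lebesgue S"
    have "ennreal (1/6) = ennreal ((c - a) / 6) / ennreal (c - a)"
      using * by (simp add: divide_ennreal)
    also have "\<dots> \<le> emeasure lebesgue S / ennreal (c - a)" by (rule divide_right_mono_ennreal) fact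
    also have "\<dots> \<le> ennreal C * epowr (?W S / ?W {a<..<b}) \<delta>" using * by (intro A) auto
    finally have le: "ennreal (1/6) \<le> ennreal C * epowr (?W S / ?W {a<..<b}) \<delta>" .
    show "?W {a<..<b} \<le> ennreal K * ?W S"
    proof (cases "?W S = top \<or> ?W {a<..<b} = 0")
      case True
      then show ?thesis using K by (auto simp: ennreal_mult_top)
    next
      case False
      then obtain u where u: "?W S = ennreal u" "u \<ge> 0" by (cases "?W S") auto
      \<comment> \<open>As \<open>S\<close> has finite mass, an infinite mass of \<open>(a,b)\<close> would make the quotient in \<open>le\<close> zero.\<close>
      have "?W {a<..<b} \<noteq> top"
      proof
        assume "?W {a<..<b} = top"
        then show False using le u by (simp add: epowr_def)
      qed
      then obtain v where v: "?W {a<..<b} = ennreal v" "v > 0"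
        using False by (cases "?W {a<..<b}") auto
      have "epowr (?W S / ?W {a<..<b}) \<delta> = ennreal ((u / v) powr \<delta>)"
        using u v by (simp add: divide_ennreal epowr_def)
      then have "1/6 \<le> C * (u / v) powr \<delta>"
        using le C by (simp add: ennreal_mult[symmetric])
      then have "1 \<le> (6 * C) * (u / v) powr \<delta>" by simp
      also have "6 * C = K powr \<delta>" using C by (simp add: K_def powr_powr)
      also have "K powr \<delta> * (u / v) powr \<delta> = (K * (u / v)) powr \<delta>"
        using K u v by (subst powr_mult) auto
      finally have "1 \<le> (K * (u / v)) powr \<delta>" .
      then have "1 \<le> K * (u / v)"
        using powr_less_mono2[of \<delta> "K * (u / v)" 1] K u v C by (force simp: not_le[symmetric])
      then have "v \<le> K * u" using v by (simp add: field_simps)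
      then show ?thesis using u v K by (simp add: ennreal_mult[symmetric])
    qed
  qed
  then show "\<exists>K. forward_comparable K w" ..
qed

lemma emeasure_weight_measure_ge:
  assumes w: "weight w" and S: "S \<in> sets lebesgue" "S \<subseteq> {..0}" and \<tau>: "\<And>t. t \<in> S \<Longrightarrow> \<tau> \<le> w t"
  shows "ennreal \<tau> * emeasure lebesgue S \<le> emeasure (weight_measure w) S"
proof -
  have "ennreal \<tau> * emeasure lebesgue S = (\<integral>\<^sup>+t. ennreal \<tau> * indicator S t \<partial>lebesgue)"
    using S by (simp add: nn_integral_cmult_indicator)
  also have "\<dots> \<le> (\<integral>\<^sup>+t\<in>S. ennreal (w t) \<partial>lebesgue)"
    using \<tau> by (intro nn_integral_mono) (auto simp: indicator_def intro: ennreal_leI)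
  finally show ?thesis using emeasure_weight_measure[OF w S] by simp
qed

text \<open>Where \<open>w\<close> is below a threshold \<open>\<tau>\<close>, its negative power is large, so the integral \<open>\<sigma>\<close> of that power
  bounds the measure of \<open>{w < \<tau>}\<close> (Chebyshev). With \<open>\<tau>\<close> chosen such that \<open>{w < \<tau>}\<close> covers at most half
  of the length that \<open>S\<close> must have, \<open>w\<close> is at least \<open>\<tau>\<close> on the rest of \<open>S\<close>, which bounds the
  mass of \<open>S\<close> from below by a multiple of \<open>\<sigma> powr (1 - p)\<close>; the Muckenhoupt condition bounds the mass of
  \<open>(a,b)\<close> from above by a multiple of the same quantity.\<close>

lemma Ap_plus_forward_comparable:
  assumes p: "1 < p" and w: "weight w" and A: "Ap_plus_const p w \<le> ennreal B" and B: "0 \<le> B"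
  shows "forward_comparable (12 powr p * B) w"
  unfolding forward_comparable_def
proof (intro allI impI)
  let ?W = "emeasure (weight_measure w)"
  fix a b c :: real and S
  assume abc: "a < b" "b < c" "c \<le> 0" and S: "S \<in> sets lebesgue" "S \<subseteq> {b..c}"
    and large: "ennreal ((c - a) / 6) \<le> emeasure lebesgue S"
  define q where "q = 1 - p / (p - 1)"
  have q: "q = - (1 / (p - 1))" using p by (simp add: q_def field_simps)
  have q_neg: "q < 0" using p by (simp add: q)
  define \<sigma> where "\<sigma> = (\<integral>\<^sup>+t\<in>{b..c}. ennreal (w t powr q) \<partial>lebesgue)"
  have ab_neg: "{a<..<b} \<subseteq> {..0}" "{b..c} \<subseteq> {..0}" "S \<subseteq> {..0}" using abc S by auto
  have W_ab: "?W {a<..<b} \<le> (\<integral>\<^sup>+t\<in>{a..b}. ennreal (w t) \<partial>lebesgue)"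
    unfolding emeasure_weight_measure[OF w _ ab_neg(1), simplified]
    by (intro nn_integral_mono) (auto simp: indicator_def)
  have "(\<integral>\<^sup>+t\<in>{a..b}. ennreal (w t) \<partial>lebesgue) * epowr \<sigma> (p - 1) / ennreal ((c - a) powr p)
      \<le> Ap_plus_const p w"
    unfolding Ap_plus_const_def \<sigma>_def q_def using abc
    by (intro SUP_upper2[of "(a, b, c)"]) auto
  also note A
  finally have le: "(\<integral>\<^sup>+t\<in>{a..b}. ennreal (w t) \<partial>lebesgue) * epowr \<sigma> (p - 1) / ennreal ((c - a) powr p) \<le> ennreal B" .
  have ca: "(c - a) powr p > 0" using abc by simp
  have "?W {a<..<b} * epowr \<sigma> (p - 1) \<le> (\<integral>\<^sup>+t\<in>{a..b}. ennreal (w t) \<partial>lebesgue) * epowr \<sigma> (p - 1)"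
    by (rule mult_right_mono[OF W_ab]) simp
  also have "\<dots> = (\<integral>\<^sup>+t\<in>{a..b}. ennreal (w t) \<partial>lebesgue) * epowr \<sigma> (p - 1)
      / ennreal ((c - a) powr p) * ennreal ((c - a) powr p)"
    using ca by (simp add: ennreal_divide_times)
  also have "\<dots> \<le> ennreal B * ennreal ((c - a) powr p)"
    by (rule mult_right_mono[OF le]) simp
  finally have prod: "?W {a<..<b} * epowr \<sigma> (p - 1) \<le> ennreal (B * (c - a) powr p)"
    using B by (simp add: ennreal_mult)
  show "?W {a<..<b} \<le> ennreal (12 powr p * B) * ?W S"
  proof (cases "?W {a<..<b} = 0")
    case False
    have "\<sigma> \<noteq> top"
    proof
      assume "\<sigma> = top"
      then have "top \<le> ennreal (B * (c - a) powr p)"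
        using prod False by (simp add: epowr_def ennreal_mult_top)
      then show False by (simp add: top_unique)
    qed
    have wm: "(\<lambda>t. w t * indicator {..0} t) \<in> borel_measurable lebesgue"
      using w by (simp add: weight_def borel_measurable_restrict_space_iff mult.commute)
    have m: "(\<lambda>t. ennreal (w t powr q) * indicator {b..c} t) \<in> borel_measurable lebesgue"
    proof -
      have "(\<lambda>t. ennreal ((w t * indicator {..0} t) powr q)) \<in> borel_measurable lebesgue"
        using wm by measurable
      then have "(\<lambda>t. ennreal ((w t * indicator {..0} t) powr q) * indicator {b..c} t) \<in> borel_measurable lebesgue"
        by (intro borel_measurable_times_ennreal borel_measurable_indicator) simp_all
      then show ?thesis
        by (rule measurable_cong[THEN iffD1, rotated]) (use ab_neg in \<open>auto simp: indicator_def\<close>)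
    qed
    have "\<sigma> \<noteq> 0"
    proof
      assume "\<sigma> = 0"
      then have "AE t in lebesgue. ennreal (w t powr q) * indicator {b..c} t = 0"
        unfolding \<sigma>_def using m by (simp add: nn_integral_0_iff_AE)
      moreover have "AE t in lebesgue. t \<in> {..0} \<longrightarrow> 0 < w t"
        using w by (simp add: weight_def AE_restrict_space_iff)
      ultimately have "AE t in lebesgue. t \<notin> {b..c}"
        by eventually_elim (use ab_neg in \<open>auto simp: indicator_def split: if_splits\<close>)
      then have "emeasure lebesgue {b..c} = 0"
        by (subst (asm) AE_iff_null_sets[symmetric]) auto
      then show False using abc by simp
    qed
    then obtain r where r: "\<sigma> = ennreal r" "r > 0" using \<open>\<sigma> \<noteq> top\<close> by (cases \<sigma>) auto
    define L where "L = (c - a) / 12"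
    have L: "L > 0" using abc by (simp add: L_def)
    define \<tau> where "\<tau> = (L / r) powr (p - 1)"
    have \<tau>: "\<tau> > 0" "\<tau> powr q = r / L"
      using r L p by (auto simp: \<tau>_def powr_powr q powr_minus_divide)
    define T where "T = S \<inter> {t. w t * indicator {..0} t < \<tau>}"
    have T: "T \<in> sets lebesgue"
    proof -
      have "{t \<in> space lebesgue. w t * indicator {..0} t < \<tau>} \<in> sets lebesgue"
        using wm by measurable
      then show ?thesis using S by (auto simp: T_def)
    qed
    have "ennreal (r / L) * emeasure lebesgue T = (\<integral>\<^sup>+t. ennreal (r / L) * indicator T t \<partial>lebesgue)"
      using T by (simp add: nn_integral_cmult_indicator)
    also have "\<dots> \<le> (\<integral>\<^sup>+t\<in>{b..c}. ennreal (w t powr q) \<partial>lebesgue)"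
    proof (rule nn_integral_mono_AE)
      have "AE t in lebesgue. t \<in> {..0} \<longrightarrow> 0 < w t"
        using w by (simp add: weight_def AE_restrict_space_iff)
      then show "AE t in lebesgue. ennreal (r / L) * indicator T t \<le> ennreal (w t powr q) * indicator {b..c} t"
      proof eventually_elim
        case (elim t)
        show ?case
        proof (cases "t \<in> T")
          case True
          then have t: "t \<in> {b..c}" "0 < w t" "w t < \<tau>" using S ab_neg elim by (auto simp: T_def)
          have "\<tau> powr q \<le> w t powr q" using t q_neg by (intro powr_mono2') auto
          then show ?thesis using t \<tau> by (auto simp: indicator_def intro: ennreal_leI)
        qed simp
      qed
    qed
    also have "\<dots> = ennreal r" using r by (simp add: \<sigma>_def)
    finally have "ennreal (r / L) * emeasure lebesgue T \<le> ennreal r" .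
    then have "ennreal (L / r) * (ennreal (r / L) * emeasure lebesgue T) \<le> ennreal (L / r) * ennreal r"
      by (intro mult_left_mono) auto
    then have T_le: "emeasure lebesgue T \<le> ennreal L"
      using r L by (simp add: mult.assoc[symmetric] ennreal_mult[symmetric])
    have "2 * L = (c - a) / 6" by (simp add: L_def)
    then have "ennreal (2 * L) \<le> emeasure lebesgue S" using large by (simp only:)
    also have "\<dots> \<le> emeasure lebesgue ((S - T) \<union> T)"
      using S T by (intro emeasure_mono) auto
    also have "\<dots> \<le> emeasure lebesgue (S - T) + emeasure lebesgue T"
      using S T by (intro emeasure_subadditive) auto
    also have "\<dots> \<le> emeasure lebesgue (S - T) + ennreal L" by (intro add_left_mono T_le)
    finally have "ennreal (2 * L) - ennreal L \<le> emeasure lebesgue (S - T)"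
      by (subst ennreal_minus_le_iff) (auto simp: add.commute)
    then have "ennreal L \<le> emeasure lebesgue (S - T)"
      using L by (subst (asm) ennreal_minus) auto
    then have "ennreal \<tau> * ennreal L \<le> ennreal \<tau> * emeasure lebesgue (S - T)"
      by (intro mult_left_mono) auto
    also have "\<dots> \<le> ?W (S - T)"
    proof (rule emeasure_weight_measure_ge[OF w])
      show "S - T \<in> sets lebesgue" using S T by auto
      show "S - T \<subseteq> {..0}" using ab_neg by auto
      fix t assume "t \<in> S - T"
      then show "\<tau> \<le> w t" using ab_neg by (auto simp: T_def)
    qed
    also have "\<dots> \<le> ?W S"
      using S ab_neg by (intro emeasure_mono) (auto simp: in_sets_weight_measure)
    finally have WS: "ennreal (\<tau> * L) \<le> ?W S" using \<tau> L by (simp add: ennreal_mult)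
    have "epowr \<sigma> (p - 1) = ennreal (r powr (p - 1))" using r by (simp add: epowr_def)
    then have "?W {a<..<b} * ennreal (r powr (p - 1)) \<le> ennreal (B * (c - a) powr p)"
      using prod by simp
    then have "?W {a<..<b} * ennreal (r powr (p - 1)) * ennreal (1 / r powr (p - 1))
        \<le> ennreal (B * (c - a) powr p) * ennreal (1 / r powr (p - 1))"
      by (rule mult_right_mono) simp
    then have "?W {a<..<b} \<le> ennreal (B * (c - a) powr p / r powr (p - 1))"
      using r B by (simp add: mult.assoc ennreal_mult[symmetric])
    also have "B * (c - a) powr p / r powr (p - 1) = 12 powr p * B * (\<tau> * L)"
    proof -
      have "c - a = 12 * L" by (simp add: L_def)
      then have "(c - a) powr p = 12 powr p * L powr p"
        using powr_mult[of 12 L p] L by simp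
      also have "L powr p = L powr (p - 1) * L" using L by (simp add: powr_mult_base[symmetric] powr_diff)
      finally show ?thesis using r L by (simp add: \<tau>_def powr_divide)
    qed
    also have "ennreal \<dots> = ennreal (12 powr p * B) * ennreal (\<tau> * L)"
      using B \<tau> L by (subst ennreal_mult[symmetric]) auto
    also have "\<dots> \<le> ennreal (12 powr p * B) * ?W S" by (intro mult_left_mono WS) simp
    finally show ?thesis .
  qed simp
qed

text \<open>Cut \<open>[x,b)\<close> at the points \<open>b - (b - x) / 2 ^ k\<close>. A set \<open>E\<close> that fills at most a quarter of
  every \<open>[y,b)\<close> covers at most half of each piece. Hence the mass of a piece is controlled by the mass of
  the next piece outside \<open>E\<close>, and these masses are summed.\<close>

lemma emeasure_weight_le_Diff:
  assumes w: "weight w" and K: "forward_comparable K w" and xb: "x < b" "b \<le> 0"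
    and E: "E \<in> sets lebesgue"
    and sparse: "\<And>y. x \<le> y \<Longrightarrow> y < b \<Longrightarrow> emeasure lebesgue (E \<inter> {y..<b}) \<le> ennreal ((b - y) / 4)"
  shows "emeasure (weight_measure w) {x..<b}
    \<le> ennreal K * emeasure (weight_measure w) ({x..<b} - E)"
proof -
  let ?W = "emeasure (weight_measure w)"
  define X where "X k = b - (b - x) / 2 ^ k" for k :: nat
  define I where "I k = {X k..<X (Suc k)}" for k
  have X0: "X 0 = x" by (simp add: X_def)
  have Xb: "X k < b" for k using xb by (simp add: X_def)
  have X_step: "X (Suc k) - X k = (b - x) / 2 ^ (Suc k)" for k by (simp add: X_def field_simps)
  have X_less: "X k < X (Suc k)" for k
    using X_step[of k] xb by (smt (verit) divide_pos_pos zero_less_power)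
  have X_mono: "i \<le> j \<Longrightarrow> X i \<le> X j" for i j
    by (rule lift_Suc_mono_le[of X]) (auto intro: less_imp_le X_less)
  have xX: "x \<le> X k" for k using X_mono[of 0 k] X0 by simp
  have disj: "disjoint_family I"
  proof -
    have "I i \<inter> I j = {}" if "i < j" for i j
      using X_mono[of "Suc i" j] that by (auto simp: I_def)
    then show ?thesis unfolding disjoint_family_on_def by (metis inf_commute linorder_neqE_nat)
  qed
  have Un: "(\<Union>k. I k) = {x..<b}"
  proof
    show "(\<Union>k. I k) \<subseteq> {x..<b}"
      unfolding I_def using xX Xb by (force intro: order_trans less_trans)
    show "{x..<b} \<subseteq> (\<Union>k. I k)"
    proof
      fix y assume y: "y \<in> {x..<b}"
      obtain n where n: "(1/2::real) ^ n < (b - y) / (b - x)"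
        using real_arch_pow_inv[of "(b - y) / (b - x)" "1/2"] y by auto
      then have "y < X n" using xb by (simp add: X_def field_simps)
      define m where "m = (LEAST n. y < X n)"
      have m: "y < X m" unfolding m_def by (rule LeastI) fact
      then obtain k where k: "m = Suc k" using y X0 by (cases m) auto
      have "\<not> y < X k" using not_less_Least[of k "\<lambda>n. y < X n"] k m_def by auto
      then have "y \<in> I k" using m k by (simp add: I_def)
      then show "y \<in> (\<Union>k. I k)" by blast
    qed
  qed
  have Xneg: "X k \<le> 0" for k using Xb[of k] xb by simp
  have I_sets: "I k \<in> sets (weight_measure w)" for k
    using Xneg[of "Suc k"] by (auto simp: I_def in_sets_weight_measure)
  have ID_sets: "I k - E \<in> sets (weight_measure w)" for k
    using I_sets[of k] E by (auto simp: in_sets_weight_measure)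
  have step: "?W (I k) \<le> ennreal K * ?W (I (Suc k) - E)" for k
  proof -
    \<comment> \<open>The length of the piece following \<open>I k\<close>, so that \<open>X (Suc (Suc k)) - X k = 3 * L\<close>.\<close>
    define L where "L = (b - x) / 2 ^ (Suc (Suc k))"
    have L: "L > 0" "X (Suc (Suc k)) - X (Suc k) = L" "X (Suc k) - X k = 2 * L" "b - X (Suc k) = 2 * L"
      using X_step[of "Suc k"] X_step[of k] xb by (auto simp: L_def X_def field_simps)
    have "ennreal L = emeasure lebesgue (I (Suc k))"
      using L X_less[of "Suc k"] by (simp add: I_def)
    also have "\<dots> \<le> emeasure lebesgue ((I (Suc k) - E) \<union> (E \<inter> {X (Suc k)..<b}))"
      using E Xb[of "Suc (Suc k)"] by (intro emeasure_mono) (auto simp: I_def)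
    also have "\<dots> \<le> emeasure lebesgue (I (Suc k) - E) + emeasure lebesgue (E \<inter> {X (Suc k)..<b})"
      using E by (intro emeasure_subadditive) (auto simp: I_def)
    also have "\<dots> \<le> emeasure lebesgue (I (Suc k) - E) + ennreal (L / 2)"
      using sparse[OF xX Xb, of "Suc k"] L by (intro add_left_mono) simp
    finally have "ennreal L - ennreal (L / 2) \<le> emeasure lebesgue (I (Suc k) - E)"
      by (subst ennreal_minus_le_iff) (auto simp: add.commute)
    moreover have "ennreal L - ennreal (L / 2) = ennreal ((X (Suc (Suc k)) - X k) / 6)"
      using L by (subst ennreal_minus) (auto intro!: arg_cong[where f=ennreal])
    ultimately have large: "ennreal ((X (Suc (Suc k)) - X k) / 6) \<le> emeasure lebesgue (I (Suc k) - E)"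
      by simp
    have "?W (I k) = ?W {X k<..<X (Suc k)}"
      unfolding I_def using w X_less Xneg by (rule emeasure_weight_measure_half_open)
    also have "\<dots> \<le> ennreal K * ?W (I (Suc k) - E)"
      using E by (intro forward_comparableD[OF K X_less X_less Xneg _ _ large]) (auto simp: I_def)
    finally show ?thesis .
  qed
  have "?W {x..<b} = (\<Sum>k. ?W (I k))"
    using suminf_emeasure[OF _ disj, of "weight_measure w"] I_sets Un by (simp add: image_subset_iff)
  also have "\<dots> \<le> (\<Sum>k. ennreal K * ?W (I (Suc k) - E))"
    using step by (intro suminf_le summableI) auto
  also have "\<dots> = ennreal K * (\<Sum>k. ?W (I (Suc k) - E))" by (rule ennreal_suminf_cmult)
  also have "(\<Sum>k. ?W (I (Suc k) - E)) = ?W (\<Union>k. I (Suc k) - E)"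
  proof (rule suminf_emeasure)
    show "range (\<lambda>k. I (Suc k) - E) \<subseteq> sets (weight_measure w)" using ID_sets by auto
    show "disjoint_family (\<lambda>k. I (Suc k) - E)"
      using disj by (auto simp: disjoint_family_on_def) blast
  qed
  also have "ennreal K * \<dots> \<le> ennreal K * ?W ({x..<b} - E)"
    using E Un xb by (intro mult_left_mono emeasure_mono) (auto simp: in_sets_weight_measure)
  finally show ?thesis .
qed

section \<open>The good-\<open>\<lambda>\<close> inequality\<close>

lemma (in nonneg_loc_integrable) max_level_subset_neg:
  assumes "\<And>x. 0 < x \<Longrightarrow> g x = 0" and "0 \<le> \<alpha>"
  shows "max_level g \<alpha> \<subseteq> {..<0}"
proof
  fix t assume "t \<in> max_level g \<alpha>"
  then obtain h where h: "h > 0" "\<alpha> * h < integral {t..t+h} g" by (auto simp: max_level_def)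
  show "t \<in> {..<0}"
  proof (rule ccontr)
    assume "t \<notin> {..<0}"
    then have "integral {t..t+h} g = integral {t..t+h} (\<lambda>_. 0)"
      using assms(1) by (intro integral_spike[of "{t}"]) auto
    then show False using h assms(2) by (simp add: mult_less_0_iff)
  qed
qed

text \<open>The exceptional set \<open>E\<close> is where the maximal function exceeds \<open>\<rho> * \<alpha>\<close> although the sharp function
  is at most \<open>(\<rho> - 1) / 8 * \<alpha>\<close>; the factor \<open>1/8\<close> makes \<open>E\<close> fill at most a quarter of each interval ending
  at a boundary point of the level set \<open>U\<close>. Then \<open>U\<close> has at most \<open>K\<close> times the mass of \<open>U - E\<close>. As
  the mass of \<open>U\<close> is finite, \<open>E\<close> carries at most the fraction \<open>1 - 1/K\<close> of it, and this fraction does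
  not depend on \<open>\<rho>\<close>.\<close>

lemma (in nonneg_loc_integrable) good_lambda:
  assumes vanish: "\<And>x. 0 < x \<Longrightarrow> g x = 0"
    and w: "weight w" and K: "forward_comparable K w" "1 \<le> K"
    and \<alpha>: "0 < \<alpha>" and \<rho>: "1 < \<rho>"
    and fin: "emeasure (weight_measure w) (max_level g \<alpha>) < top"
  shows "emeasure (weight_measure w) (max_level g (\<rho> * \<alpha>))
    \<le> ennreal (1 - 1 / K) * emeasure (weight_measure w) (max_level g \<alpha>)
      + emeasure (weight_measure w) (sharp_level g ((\<rho> - 1) / 8 * \<alpha>) \<inter> {..0})"
proof -
  let ?W = "emeasure (weight_measure w)"
  define \<mu> where "\<mu> = (\<rho> - 1) / 8 * \<alpha>"
  define U where "U = max_level g \<alpha>"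
  define V where "V = max_level g (\<rho> * \<alpha>)"
  define E where "E = V - sharp_level g \<mu>"
  have \<mu>: "\<mu> > 0" using \<alpha> \<rho> by (simp add: \<mu>_def)
  have less: "\<alpha> < \<rho> * \<alpha>" using \<alpha> \<rho> by simp
  have U: "open U" "U \<subseteq> {..<0}" using open_max_level max_level_subset_neg[OF vanish] \<alpha> by (auto simp: U_def)
  have VU: "V \<subseteq> U" unfolding U_def V_def by (rule max_level_mono) (use less in simp)
  have [measurable]: "V \<in> sets lebesgue" "U \<in> sets lebesgue" "sharp_level g \<mu> \<in> sets lebesgue"
    using open_max_level open_sharp_level by (auto simp: U_def V_def)
  have E: "E \<in> sets lebesgue" by (simp add: E_def)
  define \<omega> where "\<omega> = (\<lambda>t. ennreal (w t) * indicator {..0} t)"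
  have [measurable]: "\<omega> \<in> borel_measurable lebesgue"
    unfolding \<omega>_def by (rule borel_measurable_extend_weight[OF w])
  define M :: "real measure" where "M = density lebesgue \<omega>"
  define N :: "real measure" where "N = density lebesgue (\<lambda>t. ennreal K * (\<omega> t * indicator (- E) t))"
  have [measurable]: "(\<lambda>t. ennreal K * (\<omega> t * indicator (- E) t)) \<in> borel_measurable lebesgue"
    using E by (intro borel_measurable_times_ennreal borel_measurable_indicator)
      (auto simp: Compl_in_sets_lebesgue)
  have M: "emeasure M S = ?W S" and N: "emeasure N S = ennreal K * ?W (S - E)"
    if S: "S \<in> sets lebesgue" "S \<subseteq> {..0}" for S
  proof -
    have "emeasure M S = (\<integral>\<^sup>+t\<in>S. \<omega> t \<partial>lebesgue)"
      unfolding M_def using S by (subst emeasure_density) auto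
    also have "\<dots> = (\<integral>\<^sup>+t\<in>S. ennreal (w t) \<partial>lebesgue)"
      using S by (intro nn_integral_cong) (auto simp: \<omega>_def indicator_def)
    finally show "emeasure M S = ?W S" using emeasure_weight_measure[OF w S] by simp
    have "emeasure N S = (\<integral>\<^sup>+t. ennreal K * (\<omega> t * indicator (- E) t) * indicator S t \<partial>lebesgue)"
      unfolding N_def using S by (subst emeasure_density) auto
    also have "\<dots> = (\<integral>\<^sup>+t. ennreal K * (\<omega> t * indicator (S - E) t) \<partial>lebesgue)"
      by (intro nn_integral_cong) (auto simp: indicator_def)
    also have "\<dots> = ennreal K * (\<integral>\<^sup>+t. \<omega> t * indicator (S - E) t \<partial>lebesgue)"
      using S E by (intro nn_integral_cmult borel_measurable_times_ennreal borel_measurable_indicator) auto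
    also have "(\<integral>\<^sup>+t. \<omega> t * indicator (S - E) t \<partial>lebesgue) = (\<integral>\<^sup>+t\<in>S-E. ennreal (w t) \<partial>lebesgue)"
      using S by (intro nn_integral_cong) (auto simp: \<omega>_def indicator_def)
    also have "\<dots> = ?W (S - E)"
      using S E by (intro emeasure_weight_measure[OF w, symmetric]) auto
    finally show "emeasure N S = ennreal K * ?W (S - E)" .
  qed
  have "emeasure M U \<le> emeasure N U"
  proof (rule emeasure_le_by_half_open_intervals)
    show "open U" by fact
    show "bdd_above U" using U(2) by (rule bdd_above_mono[rotated]) auto
    show "sets borel \<subseteq> sets M" "sets borel \<subseteq> sets N" by (auto simp: M_def N_def)
    fix x b assume x: "x < b" "{x..<b} \<subseteq> U" "b \<notin> U"
    have b: "b \<le> 0"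
    proof (rule ccontr)
      assume "\<not> b \<le> 0"
      then have "max x 0 \<in> {x..<b}" using x by auto
      then have "max x 0 \<in> U" using x(2) by blast
      then show False using U(2) by auto
    qed
    have "emeasure lebesgue (E \<inter> {y..<b}) \<le> ennreal ((b - y) / 4)" if "x \<le> y" "y < b" for y
    proof -
      have "emeasure lebesgue (E \<inter> {y..<b}) \<le> ennreal (2 * \<mu> / (\<rho> * \<alpha> - \<alpha>) * (b - y))"
        unfolding E_def V_def using x(3) that(2) \<mu> less unfolding U_def
        by (rule emeasure_exceptional_le)
      also have "2 * \<mu> / (\<rho> * \<alpha> - \<alpha>) * (b - y) = (b - y) / 4"
        using \<alpha> \<rho> by (simp add: \<mu>_def field_simps)
      finally show ?thesis .
    qed
    then have "?W {x..<b} \<le> ennreal K * ?W ({x..<b} - E)"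
      by (intro emeasure_weight_le_Diff[OF w K(1) x(1) b E]) auto
    then show "emeasure M {x..<b} \<le> emeasure N {x..<b}"
      using b by (subst M N, simp, force)+
  qed
  then have le: "?W U \<le> ennreal K * ?W (U - E)"
    using U by (subst (asm) M, simp, force, subst (asm) N) auto
  have sets: "U \<in> sets (weight_measure w)" "E \<in> sets (weight_measure w)" "E \<subseteq> U" "V \<in> sets (weight_measure w)"
    "sharp_level g \<mu> \<inter> {..0} \<in> sets (weight_measure w)"
    using U VU E by (auto simp: in_sets_weight_measure E_def)
  obtain u where u: "?W U = ennreal u" "u \<ge> 0" using fin unfolding U_def by (cases "?W U") (auto simp: U_def)
  have "?W E \<le> ?W U" using sets by (intro emeasure_mono) auto
  then obtain e where e: "?W E = ennreal e" "e \<ge> 0" using u by (cases "?W E") (auto simp: top_unique)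
  have "?W (U - E) = ennreal (u - e)"
    using sets e u by (subst emeasure_Diff) (auto simp: ennreal_minus)
  then have "ennreal u \<le> ennreal (K * (u - e))" using le u K by (simp add: ennreal_mult')
  moreover have "e \<le> u" using \<open>?W E \<le> ?W U\<close> e u by simp
  ultimately have "u \<le> K * (u - e)" using K by (simp add: ennreal_le_iff)
  then have "e \<le> (1 - 1 / K) * u" using K by (simp add: field_simps)
  then have "?W E \<le> ennreal (1 - 1 / K) * ?W U"
    using K u e by (simp add: ennreal_mult[symmetric])
  have "?W V \<le> ?W (E \<union> (sharp_level g \<mu> \<inter> {..0}))"
    using sets VU U by (intro emeasure_mono) (auto simp: E_def)
  also have "\<dots> \<le> ?W E + ?W (sharp_level g \<mu> \<inter> {..0})"
    using sets by (intro emeasure_subadditive) auto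
  also have "\<dots> \<le> ennreal (1 - 1 / K) * ?W U + ?W (sharp_level g \<mu> \<inter> {..0})"
    by (intro add_right_mono) fact
  finally show ?thesis by (simp add: U_def V_def \<mu>_def)
qed

section \<open>Integrating a good-\<open>\<lambda>\<close> inequality\<close>

lemma epowr_ennreal: "0 \<le> r \<Longrightarrow> epowr (ennreal r) p = ennreal (r powr p)"
  by (simp add: epowr_def)

lemma epowr_top: "epowr top p = top"
  by (simp add: epowr_def)

lemma borel_measurable_epowr [measurable (raw)]:
  assumes f [measurable]: "f \<in> borel_measurable M"
  shows "(\<lambda>x. epowr (f x) p) \<in> borel_measurable M"
proof -
  have "(\<lambda>x. p) \<in> borel_measurable M" by simp
  moreover have "{x \<in> space M. f x = top} \<in> sets M"
    using measurable_sets[OF f, of "{top}"] by (simp add: vimage_def Int_def conj_commute)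
  ultimately show ?thesis unfolding epowr_def by measurable
qed

lemma epowr_cmult:
  assumes "0 < c"
  shows "epowr (ennreal c * y) p = ennreal (c powr p) * epowr y p"
proof (cases y)
  case (real r)
  then show ?thesis using assms
    by (simp add: epowr_ennreal ennreal_mult[symmetric] powr_mult)
next
  case top
  then show ?thesis using assms by (simp add: epowr_top ennreal_mult_top)
qed

lemma less_cmult_ennreal_iff:
  assumes "0 < c" "0 \<le> \<alpha>"
  shows "ennreal \<alpha> < ennreal c * y \<longleftrightarrow> ennreal (\<alpha> / c) < y"
proof (cases y)
  case (real r)
  then show ?thesis using assms
    by (simp add: ennreal_mult[symmetric] ennreal_less_iff field_simps)
next
  case top
  then show ?thesis using assms by (simp add: ennreal_mult_top)
qed

lemma epowr_mono: "0 < p \<Longrightarrow> x \<le> y \<Longrightarrow> epowr x p \<le> epowr y p"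
  by (cases x; cases y) (auto simp: epowr_ennreal epowr_top top_unique intro!: ennreal_leI powr_mono2)

lemma epowr_layer_cake:
  assumes p: "0 < p"
  shows "epowr y p = (\<integral>\<^sup>+\<alpha>. ennreal (p * \<alpha> powr (p - 1)) * indicator {\<alpha>. 0 < \<alpha> \<and> ennreal \<alpha> < y} \<alpha> \<partial>lborel)"
    (is "_ = ?I y")
proof -
  have fin: "?I (ennreal r) = ennreal (r powr p)" if r: "0 \<le> r" for r
  proof -
    have "((\<lambda>\<alpha>. \<alpha> powr (p - 1)) has_integral (r powr (p - 1 + 1) / (p - 1 + 1))) {0..r}"
      using p r by (intro has_integral_powr_from_0) auto
    then have "((\<lambda>\<alpha>. p * \<alpha> powr (p - 1)) has_integral (p * (r powr p / p))) {0..r}"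
      by (intro has_integral_mult_right) simp
    then have "(\<integral>\<^sup>+\<alpha>\<in>{0..r}. ennreal (p * \<alpha> powr (p - 1)) \<partial>lborel) = ennreal (r powr p)"
      using p nn_integral_has_integral_lebesgue'[of "{0..r}" "\<lambda>\<alpha>. p * \<alpha> powr (p - 1)"] by auto
    moreover have "?I (ennreal r) = (\<integral>\<^sup>+\<alpha>\<in>{0..r}. ennreal (p * \<alpha> powr (p - 1)) \<partial>lborel)"
    proof (rule nn_integral_cong_AE)
      have "AE \<alpha> in lborel. \<alpha> \<noteq> 0 \<and> \<alpha> \<noteq> r" by (intro AE_conjI AE_lborel_singleton)
      then show "AE \<alpha> in lborel. ennreal (p * \<alpha> powr (p - 1)) * indicator {\<alpha>. 0 < \<alpha> \<and> ennreal \<alpha> < ennreal r} \<alpha>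
          = ennreal (p * \<alpha> powr (p - 1)) * indicator {0..r} \<alpha>"
        by eventually_elim (auto simp: indicator_def ennreal_less_iff)
    qed
    ultimately show ?thesis by simp
  qed
  show ?thesis
  proof (cases y)
    case (real r)
    then show ?thesis by (simp add: fin epowr_ennreal)
  next
    case top
    have ge: "ennreal s \<le> ?I top" if s: "s > 0" for s
    proof -
      have "ennreal s = ?I (ennreal (s powr (1 / p)))"
        using fin[of "s powr (1 / p)"] s p by (simp add: powr_powr)
      also have "\<dots> \<le> ?I top"
        by (intro nn_integral_mono) (auto simp: indicator_def)
      finally show ?thesis .
    qed
    have "?I top = top"
    proof (rule ccontr)
      assume "?I top \<noteq> top"
      then obtain r where r: "?I top = ennreal r" "0 \<le> r" by (cases "?I top") auto
      then show False using ge[of "r + 1"] by simp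
    qed
    then show ?thesis using top by (simp add: epowr_top)
  qed
qed

lemma (in sigma_finite_measure) nn_integral_epowr_layer_cake:
  assumes G[measurable]: "G \<in> borel_measurable M" and p: "0 < p"
  shows "(\<integral>\<^sup>+x. epowr (G x) p \<partial>M)
    = (\<integral>\<^sup>+\<alpha>\<in>{0<..}. ennreal (p * \<alpha> powr (p - 1)) * emeasure M {x\<in>space M. ennreal \<alpha> < G x} \<partial>lborel)"
proof -
  interpret pair_sigma_finite lborel M ..
  have "(\<integral>\<^sup>+x. epowr (G x) p \<partial>M)
     = (\<integral>\<^sup>+x. \<integral>\<^sup>+\<alpha>. ennreal (p * \<alpha> powr (p - 1)) * indicator {\<alpha>. 0 < \<alpha> \<and> ennreal \<alpha> < G x} \<alpha> \<partial>lborel \<partial>M)"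
    by (simp add: epowr_layer_cake[OF p])
  also have "\<dots> = (\<integral>\<^sup>+\<alpha>. \<integral>\<^sup>+x. ennreal (p * \<alpha> powr (p - 1)) * indicator {\<alpha>. 0 < \<alpha> \<and> ennreal \<alpha> < G x} \<alpha> \<partial>M \<partial>lborel)"
    by (rule Fubini') measurable
  also have "\<dots> = (\<integral>\<^sup>+\<alpha>\<in>{0<..}. ennreal (p * \<alpha> powr (p - 1)) * emeasure M {x\<in>space M. ennreal \<alpha> < G x} \<partial>lborel)"
  proof (rule nn_integral_cong)
    fix \<alpha> :: real
    have "(\<integral>\<^sup>+x. ennreal (p * \<alpha> powr (p - 1)) * indicator {\<alpha>. 0 < \<alpha> \<and> ennreal \<alpha> < G x} \<alpha> \<partial>M)
      = (\<integral>\<^sup>+x. ennreal (p * \<alpha> powr (p - 1)) * indicator {0<..} \<alpha> * indicator {x\<in>space M. ennreal \<alpha> < G x} x \<partial>M)"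
      by (intro nn_integral_cong) (auto simp: indicator_def)
    also have "\<dots> = ennreal (p * \<alpha> powr (p - 1)) * indicator {0<..} \<alpha> * emeasure M {x\<in>space M. ennreal \<alpha> < G x}"
      by (rule nn_integral_cmult_indicator) measurable
    finally show "(\<integral>\<^sup>+x. ennreal (p * \<alpha> powr (p - 1)) * indicator {\<alpha>. 0 < \<alpha> \<and> ennreal \<alpha> < G x} \<alpha> \<partial>M)
      = ennreal (p * \<alpha> powr (p - 1)) * emeasure M {x\<in>space M. ennreal \<alpha> < G x} * indicator {0<..} \<alpha>"
      by (simp add: ac_simps)
  qed
  finally show ?thesis .
qed

lemma (in sigma_finite_measure) nn_integral_epowr_le_by_distribution:
  assumes F[measurable]: "F \<in> borel_measurable M" and G[measurable]: "G \<in> borel_measurable M"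
    and H[measurable]: "H \<in> borel_measurable M" and p: "0 < p"
    and le: "\<And>\<alpha>. 0 < \<alpha> \<Longrightarrow> emeasure M {x\<in>space M. ennreal \<alpha> < F x}
      \<le> \<theta> * emeasure M {x\<in>space M. ennreal \<alpha> < G x} + emeasure M {x\<in>space M. ennreal \<alpha> < H x}"
  shows "(\<integral>\<^sup>+x. epowr (F x) p \<partial>M) \<le> \<theta> * (\<integral>\<^sup>+x. epowr (G x) p \<partial>M) + (\<integral>\<^sup>+x. epowr (H x) p \<partial>M)"
proof -
  define D where "D F \<alpha> = ennreal (p * \<alpha> powr (p - 1)) * emeasure M {x\<in>space M. ennreal \<alpha> < F x} * indicator {0<..} \<alpha>"
    for F :: "'a \<Rightarrow> ennreal" and \<alpha>
  have [measurable]: "D F \<in> borel_measurable lborel" if [measurable]: "F \<in> borel_measurable M" for F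
    unfolding D_def by measurable
  have eq: "(\<integral>\<^sup>+x. epowr (F x) p \<partial>M) = integral\<^sup>N lborel (D F)" if "F \<in> borel_measurable M" for F
    unfolding D_def by (rule nn_integral_epowr_layer_cake[OF that p])
  have "integral\<^sup>N lborel (D F) \<le> (\<integral>\<^sup>+\<alpha>. \<theta> * D G \<alpha> + D H \<alpha> \<partial>lborel)"
  proof (rule nn_integral_mono)
    fix \<alpha> :: real
    show "D F \<alpha> \<le> \<theta> * D G \<alpha> + D H \<alpha>"
    proof (cases "0 < \<alpha>")
      case True
      then show ?thesis
        using mult_left_mono[OF le[OF True], of "ennreal (p * \<alpha> powr (p - 1))"]
        by (simp add: D_def distrib_left ac_simps)
    qed (simp add: D_def)
  qed
  also have "\<dots> = \<theta> * integral\<^sup>N lborel (D G) + integral\<^sup>N lborel (D H)"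
    by (subst nn_integral_add) (auto simp: nn_integral_cmult)
  finally show ?thesis by (simp add: eq)
qed

lemma epowr_SUP_min:
  assumes p: "0 < p"
  shows "epowr y p = (SUP n. epowr (min y (of_nat n)) p)"
proof (cases y)
  case (real r)
  obtain n where "r \<le> real n" using real_arch_simple by blast
  then have "min y (of_nat n) = y" using real by (simp add: ennreal_of_nat_eq_real_of_nat min_absorb1)
  then have "epowr y p \<le> (SUP n. epowr (min y (of_nat n)) p)"
    by (intro SUP_upper2[of n]) auto
  moreover have "(SUP n. epowr (min y (of_nat n)) p) \<le> epowr y p"
    by (intro SUP_least epowr_mono p) simp
  ultimately show ?thesis by (rule antisym)
next
  case top
  have "(SUP n. epowr (min y (of_nat n)) p) = top"
  proof (rule ennreal_SUP_eq_top)
    fix k :: nat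
    obtain n where n: "real k powr (1 / p) \<le> real n" using real_arch_simple by blast
    have "real k = (real k powr (1 / p)) powr p" using p by (simp add: powr_powr)
    also have "\<dots> \<le> real n powr p" using n p by (intro powr_mono2) auto
    finally have "of_nat k \<le> epowr (min y (of_nat n)) p"
      using top by (simp add: ennreal_of_nat_eq_real_of_nat epowr_ennreal ennreal_leI)
    then show "\<exists>n\<in>UNIV. of_nat k \<le> epowr (min y (of_nat n)) p" by blast
  qed
  then show ?thesis unfolding top epowr_top by (rule sym)
qed

lemma epowr_min_le:
  assumes "0 < p0" "p0 \<le> p"
  shows "epowr (min y (of_nat n)) p \<le> ennreal (real n powr (p - p0)) * epowr y p0"
proof -
  have "min y (of_nat n) \<le> of_nat n" by simp
  then have "min y (of_nat n) \<le> ennreal (real n)" by (simp add: ennreal_of_nat_eq_real_of_nat)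
  then obtain r where r: "min y (of_nat n) = ennreal r" "0 \<le> r" "r \<le> real n"
  proof (cases "min y (of_nat n)" rule: ennreal_cases)
    case (real r)
    with \<open>min y (of_nat n) \<le> ennreal (real n)\<close> have "ennreal r \<le> ennreal (real n)" by (simp only:)
    with real show ?thesis by (intro that[of r]) auto
  next
    case top
    with \<open>min y (of_nat n) \<le> ennreal (real n)\<close> have "top \<le> ennreal (real n)" by (simp only:)
    then show ?thesis by (simp add: top_unique)
  qed
  have "r powr p = r powr (p - p0) * r powr p0" by (simp add: powr_add[symmetric])
  also have "\<dots> \<le> real n powr (p - p0) * r powr p0"
    using r assms by (intro mult_right_mono powr_mono2) auto
  finally have "epowr (min y (of_nat n)) p \<le> ennreal (real n powr (p - p0)) * epowr (min y (of_nat n)) p0"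
    using r by (simp add: epowr_ennreal ennreal_mult[symmetric] ennreal_leI)
  also have "\<dots> \<le> ennreal (real n powr (p - p0)) * epowr y p0"
    using assms by (intro mult_left_mono epowr_mono) auto
  finally show ?thesis .
qed

text \<open>The integral of \<open>G\<close> to the power \<open>p\<close> must be finite before it can be absorbed into the left-hand side.
  Therefore \<open>G\<close> is truncated at height \<open>n\<close>: the truncation satisfies the same good-\<open>\<lambda>\<close> inequality, and
  its \<open>p\<close>-th power is bounded by a multiple of the \<open>p0\<close>-th power of \<open>G\<close>.\<close>

lemma (in sigma_finite_measure) nn_integral_epowr_le_of_good_lambda:
  assumes G[measurable]: "G \<in> borel_measurable M" and H[measurable]: "H \<in> borel_measurable M"
    and p: "0 < p0" "p0 \<le> p" and fin: "(\<integral>\<^sup>+x. epowr (G x) p0 \<partial>M) < top"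
    and pos: "0 \<le> \<theta>" "1 < \<rho>" "0 < \<gamma>" and \<theta>: "\<theta> < \<rho> powr - p"
    and good: "\<And>\<alpha>. 0 < \<alpha> \<Longrightarrow> emeasure M {x\<in>space M. ennreal (\<rho> * \<alpha>) < G x}
      \<le> ennreal \<theta> * emeasure M {x\<in>space M. ennreal \<alpha> < G x} + emeasure M {x\<in>space M. ennreal (\<gamma> * \<alpha>) < H x}"
  shows "(\<integral>\<^sup>+x. epowr (G x) p \<partial>M)
    \<le> ennreal (\<gamma> powr - p / (\<rho> powr - p - \<theta>)) * (\<integral>\<^sup>+x. epowr (H x) p \<partial>M)"
proof -
  let ?C = "\<gamma> powr - p / (\<rho> powr - p - \<theta>)" and ?Y = "\<integral>\<^sup>+x. epowr (H x) p \<partial>M"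
  have p0: "0 < p" using p by simp
  have trunc: "(\<integral>\<^sup>+x. epowr (min (G x) (of_nat n)) p \<partial>M) \<le> ennreal ?C * ?Y" for n
  proof -
    define Gn where "Gn x = min (G x) (of_nat n)" for x
    have [measurable]: "Gn \<in> borel_measurable M" unfolding Gn_def by measurable
    let ?X = "\<integral>\<^sup>+x. epowr (Gn x) p \<partial>M"
    have "?X \<le> (\<integral>\<^sup>+x. ennreal (real n powr (p - p0)) * epowr (G x) p0 \<partial>M)"
      unfolding Gn_def by (intro nn_integral_mono epowr_min_le p)
    also have "\<dots> = ennreal (real n powr (p - p0)) * (\<integral>\<^sup>+x. epowr (G x) p0 \<partial>M)"
      by (rule nn_integral_cmult) measurable
    also have "\<dots> < top" using fin by (simp add: ennreal_mult_less_top)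
    finally obtain X where X: "?X = ennreal X" "0 \<le> X" by (cases ?X) auto
    have "(\<integral>\<^sup>+x. epowr (ennreal (1 / \<rho>) * Gn x) p \<partial>M)
      \<le> ennreal \<theta> * ?X + (\<integral>\<^sup>+x. epowr (ennreal (1 / \<gamma>) * H x) p \<partial>M)"
    proof (rule nn_integral_epowr_le_by_distribution[OF _ _ _ p0])
      fix \<alpha> :: real assume \<alpha>: "0 < \<alpha>"
      have eq1: "{x\<in>space M. ennreal \<alpha> < ennreal (1 / \<rho>) * Gn x} = {x\<in>space M. ennreal (\<rho> * \<alpha>) < Gn x}"
        using \<alpha> pos less_cmult_ennreal_iff[of "1 / \<rho>" \<alpha>] by (simp add: mult.commute[of \<alpha>])
      have eq2: "{x\<in>space M. ennreal \<alpha> < ennreal (1 / \<gamma>) * H x} = {x\<in>space M. ennreal (\<gamma> * \<alpha>) < H x}"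
        using \<alpha> pos less_cmult_ennreal_iff[of "1 / \<gamma>" \<alpha>] by (simp add: mult.commute[of \<alpha>])
      have "emeasure M {x\<in>space M. ennreal (\<rho> * \<alpha>) < Gn x}
        \<le> ennreal \<theta> * emeasure M {x\<in>space M. ennreal \<alpha> < Gn x} + emeasure M {x\<in>space M. ennreal (\<gamma> * \<alpha>) < H x}"
      proof (cases "\<rho> * \<alpha> < real n")
        case True
        have "1 * \<alpha> < \<rho> * \<alpha>" using \<alpha> pos by (intro mult_strict_right_mono) auto
        then have "\<alpha> < real n" using True by linarith
        with True have "ennreal \<alpha> < of_nat n" "ennreal (\<rho> * \<alpha>) < of_nat n"
          using True \<alpha> pos by (auto simp: ennreal_of_nat_eq_real_of_nat ennreal_less_iff)
        then show ?thesis using good[OF \<alpha>] by (simp add: Gn_def)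
      next
        case False
        have "{x\<in>space M. ennreal (\<rho> * \<alpha>) < Gn x} = {}"
          using False \<alpha> pos by (auto simp: Gn_def ennreal_of_nat_eq_real_of_nat ennreal_less_iff)
        then show ?thesis by (simp only: emeasure_empty zero_le)
      qed
      then show "emeasure M {x\<in>space M. ennreal \<alpha> < ennreal (1 / \<rho>) * Gn x}
        \<le> ennreal \<theta> * emeasure M {x\<in>space M. ennreal \<alpha> < Gn x}
          + emeasure M {x\<in>space M. ennreal \<alpha> < ennreal (1 / \<gamma>) * H x}"
        unfolding eq1 eq2 .
    qed measurable
    then have le: "ennreal (\<rho> powr - p) * ?X \<le> ennreal \<theta> * ?X + ennreal (\<gamma> powr - p) * ?Y"
      using pos by (simp add: epowr_cmult nn_integral_cmult powr_divide powr_minus_divide)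
    show "(\<integral>\<^sup>+x. epowr (min (G x) (of_nat n)) p \<partial>M) \<le> ennreal ?C * ?Y"
    proof (cases ?Y)
      case (real Y)
      have "\<rho> powr - p * X \<le> \<theta> * X + \<gamma> powr - p * Y"
        using le X real pos by (simp add: ennreal_mult[symmetric] ennreal_plus[symmetric] del: ennreal_plus)
      then have "X \<le> ?C * Y" using \<theta> by (simp add: field_simps)
      then have "?X \<le> ennreal ?C * ?Y"
        using X real \<theta> by (simp add: ennreal_mult[symmetric] ennreal_leI)
      then show ?thesis by (simp add: Gn_def)
    next
      case top
      have "?C > 0" using pos \<theta> by simp
      then have "ennreal ?C * ?Y = top" unfolding top by (intro ennreal_mult_eq_top_iff[THEN iffD2]) auto
      then show ?thesis by (simp only: top_greatest)
    qed
  qed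
  have "(\<integral>\<^sup>+x. epowr (G x) p \<partial>M) = (\<integral>\<^sup>+x. (SUP n. epowr (min (G x) (of_nat n)) p) \<partial>M)"
    by (simp add: epowr_SUP_min[OF p0, symmetric])
  also have "\<dots> = (SUP n. \<integral>\<^sup>+x. epowr (min (G x) (of_nat n)) p \<partial>M)"
    by (intro nn_integral_monotone_convergence_SUP)
       (auto simp: incseq_def le_fun_def intro!: epowr_mono p0 min.mono)
  also have "\<dots> \<le> ennreal ?C * ?Y" by (intro SUP_least trunc)
  finally show ?thesis .
qed

section \<open>The maximal function and the sharp maximal function\<close>

lemma nonneg_loc_integrable_ext0:
  assumes f: "\<forall>t\<le>0. 0 \<le> f t" "locally_integrable_neg f"
  shows "nonneg_loc_integrable (ext0 f)"
proof
  show "0 \<le> ext0 f x" for x using f by (simp add: ext0_def)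
  fix a b :: real
  have "set_integrable lebesgue {min a 0..0} f"
    using f(2) by (simp add: locally_integrable_neg_def)
  then have "set_integrable lebesgue {a..min b 0} f"
    by (rule set_integrable_subset) auto
  then show "set_integrable lebesgue {a..b} (ext0 f)"
    unfolding set_integrable_def
    by (rule Bochner_Integration.integrable_cong[THEN iffD1, rotated 2])
       (auto simp: ext0_def indicator_def)
qed

lemma less_divide_ennreal_iff:
  assumes "0 < h" "0 \<le> \<alpha>" "0 \<le> y"
  shows "ennreal \<alpha> < ennreal y / ennreal h \<longleftrightarrow> \<alpha> * h < y"
  using assms by (simp add: divide_ennreal ennreal_less_iff field_simps)

context nonneg_loc_integrable
begin

lemma moving_integral_nonneg: "0 \<le> integral {a..b} g"
  using nonneg hk_integrable by (intro Henstock_Kurzweil_Integration.integral_nonneg) auto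

lemma upper_osc_nonneg: "0 \<le> upper_osc g h t"
  unfolding upper_osc_def
  by (intro Henstock_Kurzweil_Integration.integral_nonneg hk_integrable_excess) auto

end

lemma less_max_fun_iff:
  assumes f: "\<forall>t\<le>0. 0 \<le> f t" "locally_integrable_neg f" and \<alpha>: "0 \<le> \<alpha>"
  shows "ennreal \<alpha> < max_fun f t \<longleftrightarrow> t \<in> max_level (ext0 f) \<alpha>"
proof -
  interpret nonneg_loc_integrable "ext0 f" by (rule nonneg_loc_integrable_ext0[OF f])
  have "(\<integral>\<^sup>+s\<in>{t..t+h}. ennreal \<bar>ext0 f s\<bar> \<partial>lebesgue) = ennreal (integral {t..t+h} (ext0 f))" for h
    using nn_integral_has_integral_lebesgue'[OF nonneg integrable_integral[OF hk_integrable]] nonneg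
    by (simp add: nn_integral_completion)
  then show ?thesis
    using \<alpha> moving_integral_nonneg
    by (auto simp: max_fun_def less_SUP_iff less_divide_ennreal_iff max_level_def)
qed

lemma less_sharp_max_fun_iff:
  assumes f: "\<forall>t\<le>0. 0 \<le> f t" "locally_integrable_neg f" and \<alpha>: "0 \<le> \<alpha>"
  shows "ennreal \<alpha> < sharp_max_fun f t \<longleftrightarrow> t \<in> sharp_level (ext0 f) \<alpha>"
proof -
  interpret nonneg_loc_integrable "ext0 f" by (rule nonneg_loc_integrable_ext0[OF f])
  have "(LINT \<tau>:{t+h..t+2*h}|lebesgue. ext0 f \<tau>) = integral {t+h..t+2*h} (ext0 f)" for h
    by (rule set_lebesgue_integral_eq_integral(2)[OF loc_int])
  then have "(\<integral>\<^sup>+s\<in>{t..t+h}. ennreal (max (ext0 f s - (1 / h) * (LINT \<tau>:{t+h..t+2*h}|lebesgue. ext0 f \<tau>)) 0) \<partial>lebesgue)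
     = ennreal (upper_osc (ext0 f) h t)" for h
    unfolding upper_osc_def by (subst nn_integral_excess) simp
  then show ?thesis
    using \<alpha> upper_osc_nonneg
    by (auto simp: sharp_max_fun_def less_SUP_iff less_divide_ennreal_iff sharp_level_def)
qed

lemma borel_measurable_weight_measureI:
  fixes F :: "real \<Rightarrow> ennreal"
  assumes "\<And>\<alpha>. 0 \<le> \<alpha> \<Longrightarrow> open {t. ennreal \<alpha> < F t}"
  shows "F \<in> borel_measurable (weight_measure w)"
proof (rule borel_measurableI_greater)
  fix y :: ennreal
  show "{x \<in> space (weight_measure w). y < F x} \<in> sets (weight_measure w)"
  proof (cases y)
    case (real \<alpha>)
    have "{x \<in> space (weight_measure w). y < F x} = {t. ennreal \<alpha> < F t} \<inter> {..0}"
      using real by (auto simp: weight_measure_def space_restrict_space)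
    then show ?thesis
      using assms[of \<alpha>] real by (auto simp: in_sets_weight_measure intro!: sets.Int)
  qed simp
qed

text \<open>The constant depends on \<open>p\<close> and \<open>K\<close> only, which gives the uniformity over families of weights. The
  ratio \<open>\<rho>\<close> of the two levels is taken so close to \<open>1\<close> that \<open>\<rho> powr - p\<close> lies midway between \<open>1\<close> and the
  fraction \<open>\<theta> = 1 - 1/K\<close> of the good-\<open>\<lambda>\<close> inequality.\<close>

lemma nn_integral_max_fun_le_sharp_max_fun:
  assumes K: "2 \<le> K" and p: "0 < p"
  shows "\<exists>C>0. \<forall>w f p0. weight w \<longrightarrow> forward_comparable K w \<longrightarrow> (\<forall>t\<le>0. 0 \<le> f t) \<longrightarrow>
     locally_integrable_neg f \<longrightarrow> 0 < p0 \<longrightarrow> p0 \<le> p \<longrightarrow> max_fun f \<in> Lp_weighted p0 w \<longrightarrow>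
     (\<integral>\<^sup>+t. epowr (max_fun f t) p \<partial>weight_measure w)
       \<le> ennreal C * (\<integral>\<^sup>+t. epowr (sharp_max_fun f t) p \<partial>weight_measure w)"
proof -
  define \<theta> where "\<theta> = 1 - 1 / K"
  define \<rho> where "\<rho> = ((1 + \<theta>) / 2) powr (- (1 / p))"
  define \<gamma> where "\<gamma> = (\<rho> - 1) / 8"
  have \<theta>: "0 < \<theta>" "\<theta> < 1" using K by (auto simp: \<theta>_def)
  have \<rho>p: "\<rho> powr - p = (1 + \<theta>) / 2" using \<theta> p by (simp add: \<rho>_def powr_powr)
  have \<rho>: "1 < \<rho>"
    using powr_less_mono2_neg[of "- (1 / p)" "(1 + \<theta>) / 2" 1] \<theta> p by (simp add: \<rho>_def)
  have \<gamma>: "0 < \<gamma>" using \<rho> by (simp add: \<gamma>_def)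
  define C where "C = \<gamma> powr - p / (\<rho> powr - p - \<theta>)"
  have "C > 0" using \<gamma> \<theta> by (simp add: C_def \<rho>p)
  moreover have "(\<integral>\<^sup>+t. epowr (max_fun f t) p \<partial>weight_measure w)
       \<le> ennreal C * (\<integral>\<^sup>+t. epowr (sharp_max_fun f t) p \<partial>weight_measure w)"
    if w: "weight w" "forward_comparable K w" and f: "\<forall>t\<le>0. 0 \<le> f t" "locally_integrable_neg f"
      and p0: "0 < p0" "p0 \<le> p" and L: "max_fun f \<in> Lp_weighted p0 w" for w f p0
  proof -
    interpret nonneg_loc_integrable "ext0 f" by (rule nonneg_loc_integrable_ext0[OF f])
    interpret W: sigma_finite_measure "weight_measure w" by (rule sigma_finite_weight_measure[OF w(1)])
    have vanish: "ext0 f x = 0" if "0 < x" for x using that by (simp add: ext0_def)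
    have space: "space (weight_measure w) = {..0}" by (simp add: weight_measure_def)
    have G[measurable]: "max_fun f \<in> borel_measurable (weight_measure w)"
      by (rule borel_measurable_weight_measureI) (simp add: less_max_fun_iff[OF f] open_max_level)
    have H[measurable]: "sharp_max_fun f \<in> borel_measurable (weight_measure w)"
      by (rule borel_measurable_weight_measureI) (simp add: less_sharp_max_fun_iff[OF f] open_sharp_level)
    have fin: "(\<integral>\<^sup>+t. epowr (max_fun f t) p0 \<partial>weight_measure w) < top"
      using L by (simp add: Lp_weighted_def)
    have G_level: "{x \<in> space (weight_measure w). ennreal \<alpha> < max_fun f x} = max_level (ext0 f) \<alpha>"
      if "0 \<le> \<alpha>" for \<alpha>
      using max_level_subset_neg[OF vanish that] by (auto simp: space less_max_fun_iff[OF f that])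
    have H_level: "{x \<in> space (weight_measure w). ennreal \<alpha> < sharp_max_fun f x} = sharp_level (ext0 f) \<alpha> \<inter> {..0}"
      if "0 \<le> \<alpha>" for \<alpha>
      by (auto simp: space less_sharp_max_fun_iff[OF f that])
    show ?thesis
      unfolding C_def
    proof (rule W.nn_integral_epowr_le_of_good_lambda[OF G H p0 fin _ \<rho> \<gamma>])
      show "0 \<le> \<theta>" "\<theta> < \<rho> powr - p" using \<theta> \<rho>p by auto
      fix \<alpha> :: real assume \<alpha>: "0 < \<alpha>"
      let ?W = "emeasure (weight_measure w)"
      have "?W (max_level (ext0 f) \<alpha>) < top"
      proof -
        have sets: "max_level (ext0 f) \<alpha> \<in> sets (weight_measure w)"
          using max_level_subset_neg[OF vanish, of \<alpha>] \<alpha> open_max_level[of \<alpha>] by (force simp: in_sets_weight_measure)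
        have "ennreal (\<alpha> powr p0) * ?W (max_level (ext0 f) \<alpha>)
          = (\<integral>\<^sup>+t. ennreal (\<alpha> powr p0) * indicator (max_level (ext0 f) \<alpha>) t \<partial>weight_measure w)"
          using sets by (simp add: nn_integral_cmult_indicator)
        also have "\<dots> \<le> (\<integral>\<^sup>+t. epowr (max_fun f t) p0 \<partial>weight_measure w)"
        proof (rule nn_integral_mono)
          fix t
          show "ennreal (\<alpha> powr p0) * indicator (max_level (ext0 f) \<alpha>) t \<le> epowr (max_fun f t) p0"
          proof (cases "t \<in> max_level (ext0 f) \<alpha>")
            case True
            then have "ennreal \<alpha> \<le> max_fun f t" using less_max_fun_iff[OF f, of \<alpha> t] \<alpha> by simp
            then show ?thesis using epowr_mono[OF p0(1), of "ennreal \<alpha>"] \<alpha> True by (simp add: epowr_ennreal)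
          qed simp
        qed
        also have "\<dots> < top" by fact
        finally show ?thesis using \<alpha> by (auto simp: ennreal_mult_less_top)
      qed
      from good_lambda[OF vanish w _ \<alpha> \<rho> this]
      show "?W {x \<in> space (weight_measure w). ennreal (\<rho> * \<alpha>) < max_fun f x}
        \<le> ennreal \<theta> * ?W {x \<in> space (weight_measure w). ennreal \<alpha> < max_fun f x}
          + ?W {x \<in> space (weight_measure w). ennreal (\<gamma> * \<alpha>) < sharp_max_fun f x}"
        using \<alpha> \<rho> \<gamma> K by (simp add: G_level H_level \<theta>_def \<gamma>_def)
    qed
  qed
  ultimately show ?thesis by blast
qed

theorem lemma3p2:
  shows "(\<forall>w\<in>A_inf_plus. \<forall>p>0. \<exists>C::real. 0 < C \<and>
            (\<forall>f p0. (\<forall>t\<le>0. 0 \<le> f t) \<longrightarrow> locally_integrable_neg f \<longrightarrow> 0 < p0 \<longrightarrow> p0 \<le> p \<longrightarrow>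
               max_fun f \<in> Lp_weighted p0 w \<longrightarrow>
               (\<integral>\<^sup>+t. epowr (max_fun f t) p \<partial>weight_measure w)
                 \<le> ennreal C * (\<integral>\<^sup>+t. epowr (sharp_max_fun f t) p \<partial>weight_measure w)))
       \<and> (\<forall>p>1. \<forall>F. F \<subseteq> Ap_plus p \<longrightarrow> (SUP w\<in>F. Ap_plus_const p w) < top \<longrightarrow>
            (\<exists>C::(real \<Rightarrow> real) \<Rightarrow> real. bdd_above (C ` F) \<and> (\<forall>w\<in>F. 0 < C w \<and>
               (\<forall>f p0. (\<forall>t\<le>0. 0 \<le> f t) \<longrightarrow> locally_integrable_neg f \<longrightarrow> 0 < p0 \<longrightarrow> p0 \<le> p \<longrightarrow>
                  max_fun f \<in> Lp_weighted p0 w \<longrightarrow>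
                  (\<integral>\<^sup>+t. epowr (max_fun f t) p \<partial>weight_measure w)
                    \<le> ennreal (C w) * (\<integral>\<^sup>+t. epowr (sharp_max_fun f t) p \<partial>weight_measure w)))))"
proof (intro conjI ballI allI impI)
  fix w and p :: real assume w: "w \<in> A_inf_plus" and p: "0 < p"
  obtain K where "forward_comparable K w" using A_inf_plus_forward_comparable(2)[OF w] ..
  then have K: "forward_comparable (max K 2) w" by (rule forward_comparable_mono) simp
  show "\<exists>C::real. 0 < C \<and>
            (\<forall>f p0. (\<forall>t\<le>0. 0 \<le> f t) \<longrightarrow> locally_integrable_neg f \<longrightarrow> 0 < p0 \<longrightarrow> p0 \<le> p \<longrightarrow>
               max_fun f \<in> Lp_weighted p0 w \<longrightarrow>
               (\<integral>\<^sup>+t. epowr (max_fun f t) p \<partial>weight_measure w)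
                 \<le> ennreal C * (\<integral>\<^sup>+t. epowr (sharp_max_fun f t) p \<partial>weight_measure w))"
    using nn_integral_max_fun_le_sharp_max_fun[of "max K 2" p] p K A_inf_plus_forward_comparable(1)[OF w]
    by (metis max.cobounded2)
next
  fix p :: real and F assume p: "1 < p" and F: "F \<subseteq> Ap_plus p" and fin: "(SUP w\<in>F. Ap_plus_const p w) < top"
  obtain B where B: "(SUP w\<in>F. Ap_plus_const p w) = ennreal B" "0 \<le> B"
    using fin by (cases "SUP w\<in>F. Ap_plus_const p w") auto
  define K where "K = max (12 powr p * B) 2"
  have w: "weight w" "forward_comparable K w" if "w \<in> F" for w
  proof -
    show "weight w" using that F by (auto simp: Ap_plus_def)
    have "Ap_plus_const p w \<le> ennreal B" unfolding B(1)[symmetric] using that by (rule SUP_upper)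
    then show "forward_comparable K w"
      using Ap_plus_forward_comparable[OF p \<open>weight w\<close> _ B(2)] forward_comparable_mono
      by (auto simp: K_def)
  qed
  obtain C where C: "0 < C" "\<And>w f p0. weight w \<Longrightarrow> forward_comparable K w \<Longrightarrow> (\<forall>t\<le>0. 0 \<le> f t) \<Longrightarrow>
     locally_integrable_neg f \<Longrightarrow> 0 < p0 \<Longrightarrow> p0 \<le> p \<Longrightarrow> max_fun f \<in> Lp_weighted p0 w \<Longrightarrow>
     (\<integral>\<^sup>+t. epowr (max_fun f t) p \<partial>weight_measure w)
       \<le> ennreal C * (\<integral>\<^sup>+t. epowr (sharp_max_fun f t) p \<partial>weight_measure w)"
    using nn_integral_max_fun_le_sharp_max_fun[of K p] p by (auto simp: K_def)
  show "\<exists>C::(real \<Rightarrow> real) \<Rightarrow> real. bdd_above (C ` F) \<and> (\<forall>w\<in>F. 0 < C w \<and>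
               (\<forall>f p0. (\<forall>t\<le>0. 0 \<le> f t) \<longrightarrow> locally_integrable_neg f \<longrightarrow> 0 < p0 \<longrightarrow> p0 \<le> p \<longrightarrow>
                  max_fun f \<in> Lp_weighted p0 w \<longrightarrow>
                  (\<integral>\<^sup>+t. epowr (max_fun f t) p \<partial>weight_measure w)
                    \<le> ennreal (C w) * (\<integral>\<^sup>+t. epowr (sharp_max_fun f t) p \<partial>weight_measure w)))"
  proof (intro exI[of _ "\<lambda>_. C"] conjI ballI allI impI)
    show "bdd_above ((\<lambda>_. C) ` F)" by (rule bdd_aboveI2[of _ _ C]) simp
  qed (use C w in auto)
qed

end
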